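(* Consider a confounded mediated Markov decision process (M2DP) satisfying the front-door criterion, as set up in the context. Then: (i) there exists a unique optimal deterministic stationary policy $\pi^*$ whose expected discounted return $J(\pi^* )$ is no worse than that of any other policy; (ii) $\pi^*$ is greedy with respect to a weighted average of $Q^*$; in particular, for every state $s$, $$\pi^*(s)=\arg\max_{a\in\mathcal A}\Big[\sum_{\tilde a\in\mathcal A,\,m\in\mathcal M} p_m(m|s,a)\,p_b(\tilde a|s)\,Q^*(s,\tilde a,m)\Big];$$ (iii) $Q^*$ satisfies the Bellman optimality equation $$Q^*(S_t,A_t,M_t)=\mathbb E\Big[R_t+\gamma\max_{a\in\mathcal A}\sum_{\tilde a,m}p_m(m|S_{t+1},a)\,p_b(\tilde a|S_{t+1})\,Q^*(S_{t+1},\tilde a,m)\,\Big|\,S_t,A_t,M_t\Big],$$ where $\mathbb E$ is the expectation under the offline (behavior) data distribution.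
   Context: **Confounded M2DP.** The model is a tuple $(\mathcal S,\mathcal C,\mathcal A,\mathcal M,p_s,p_c,p_m,p_r,\gamma,\rho_0)$: state space $\mathcal S$ and unmeasured-confounder space $\mathcal C$ (discrete or continuous), finite action space $\mathcal A$, finite mediator space $\mathcal M$, discount factor $\gamma\in[0,1)$, initial state distribution $\rho_0$. Offline data follow: $S_0\sim\rho_0$, and at each time $t\ge 0$: $C_t\sim p_c(\cdot|S_t)$; $A_t\sim p_a(\cdot|S_t,C_t)$ (behavior policy); $M_t\sim p_m(\cdot|S_t,C_t,A_t)$; $R_t\sim p_r(\cdot|S_t,C_t,A_t,M_t)$; $S_{t+1}\sim p_s(\cdot|S_t,C_t,A_t,M_t)$; each draw is independent of the past given the displayed conditioning variables. $C_t$ is unobserved. Rewards are bounded: $|R_t|\le R_{\max}<\infty$ almost surely. Write $p_b(a|s)=\mathbb P(A_t=a|S_t=s)$ for the observed-data conditional action probability. **Front-door criterion.** (i) $M_t$ intercepts every directed path from $A_t$ to $S_{t+1}$ or $R_t$; (ii) conditioning on $S_t$, no path between $A_t$ and $M_t$ has an incoming arrow into $A_t$; (iii) conditioning on $S_t$, $A_t$ blocks every path between $M_t$ and $S_{t+1}$ or $R_t$ that has an incoming arrow into $M_t$. In this model it means: there is no direct effect of $A_t$ on $R_t$ or $S_{t+1}$ (so $p_r,p_s$ depend on $(S_t,C_t,M_t)$ only), and the mediator does not depend on the confounder: $p_m(m|s,c,a)=p_m(m|s,a)$. **Policies and values.** An (online) policy $\pi=\{\pi_t\}_{t\ge0}$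 is a sequence of conditional probability mass functions on $\mathcal A$ given the observed history $H_t$ (all observed variables up to time $t$, including $S_t$). Under $\pi$, trajectories are generated by $S_0\sim\rho_0$ and, at each time $t\ge0$: $C_t\sim p_c(\cdot|S_t)$; $A_t\sim\pi_t(\cdot|H_t)$, without any influence of $C_t$; $M_t\sim p_m(\cdot|S_t,A_t)$; $R_t\sim p_r(\cdot|S_t,C_t,A_t,M_t)$; $S_{t+1}\sim p_s(\cdot|S_t,C_t,A_t,M_t)$; $\mathbb E^\pi$ denotes the resulting expectation. A policy is Markov if $\pi_t$ depends on $H_t$ only through $S_t$, stationary if it is Markov with $\pi_0=\pi_1=\cdots$, and deterministic if each $\pi_t$ is degenerate (then $\pi_t(s)$ denotes the selected action). The return is $J(\pi)=\sum_{t\ge0}\gamma^t\mathbb E^\pi(R_t)$. The mediated Q-function is $$Q^\pi(s,a,m)=\sum_{t\ge0}\gamma^t\,\mathbb E^{\pi}\big(R_t\mid S_0=s,A_0=a,M_0=m,\ do(A_{1:\infty}\sim\pi)\big),$$ where only actions at times $t\ge1$ are intervened on (drawn from $\pi$ independently of the confounders), while $(S_0,A_0,M_0)=(s,a,m)$ is conditioned on under the offline distribution. The mediated optimal Q-function is $Q^*(s,a,m)=\sup_\pi Q^\pi(s,a,m)$, the supremum being over all policies.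
   Formalization: Uniqueness in (i) is false with ties or unvisited states; instead: policies optimal from every start are exactly the greedy ones; if each argmax is single, only π* is, and J-optimal ones equal π* a.s. along their paths (when γ^t>0). Null-event Q^π uses a fixed version. *)

theory Defs
  imports "HOL-Probability.Probability"
begin

section \<open>Confounded mediated Markov decision processes\<close>

text \<open>
  \<open>states\<close> and \<open>confs\<close> are measurable spaces; \<open>init\<close> is the distribution \<open>\<rho>\<^sub>0\<close> of the first state.
  All conditional laws are Markov kernels, the ones on the finite action and mediator spaces being
  given by probability mass functions; \<open>p_a\<close> is the behaviour policy. The mediator, reward and
  transition kernels may depend on everything drawn before them; the front-door criterion is a
  separate hypothesis.
\<close>

record ('s, 'c, 'a, 'm) m2dp =
  states :: "'s measure"
  confs :: "'c measure"
  init :: "'s measure"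
  p_c :: "'s \<Rightarrow> 'c measure"
  p_a :: "'s \<Rightarrow> 'c \<Rightarrow> 'a pmf"
  p_m :: "'s \<Rightarrow> 'c \<Rightarrow> 'a \<Rightarrow> 'm pmf"
  p_r :: "'s \<Rightarrow> 'c \<Rightarrow> 'a \<Rightarrow> 'm \<Rightarrow> real measure"
  p_s :: "'s \<Rightarrow> 'c \<Rightarrow> 'a \<Rightarrow> 'm \<Rightarrow> 's measure"
  discount :: real

locale m2dp_model =
  fixes M :: "('s, 'c, 'a::finite, 'm::finite) m2dp"
  assumes init: "init M \<in> space (prob_algebra (states M))"
    and p_c: "p_c M \<in> states M \<rightarrow>\<^sub>M prob_algebra (confs M)"
    and p_a: "\<And>a. (\<lambda>(s, c). pmf (p_a M s c) a) \<in> borel_measurable (states M \<Otimes>\<^sub>M confs M)"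
    and p_m: "\<And>a m. (\<lambda>(s, c). pmf (p_m M s c a) m) \<in> borel_measurable (states M \<Otimes>\<^sub>M confs M)"
    and p_r: "\<And>a m. (\<lambda>(s, c). p_r M s c a m) \<in> states M \<Otimes>\<^sub>M confs M \<rightarrow>\<^sub>M prob_algebra borel"
    and p_s: "\<And>a m. (\<lambda>(s, c). p_s M s c a m) \<in> states M \<Otimes>\<^sub>M confs M \<rightarrow>\<^sub>M prob_algebra (states M)"
    and discount: "0 \<le> discount M" "discount M < 1"
    and bounded_rewards: "\<exists>R_max. \<forall>s\<in>space (states M). \<forall>c\<in>space (confs M). \<forall>a m.
          AE r in p_r M s c a m. \<bar>r\<bar> \<le> R_max"

text \<open>
  The front-door criterion. The kernel \<open>q\<close> is the common value \<open>p\<^sub>m(m|s,a)\<close> of \<open>p\<^sub>m(m|s,c,a)\<close>.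
\<close>

definition front_door ::
    "('s, 'c, 'a, 'm) m2dp \<Rightarrow> ('s \<Rightarrow> 'a \<Rightarrow> 'm pmf) \<Rightarrow> bool" where
  "front_door M q \<longleftrightarrow> (\<forall>s\<in>space (states M). \<forall>c\<in>space (confs M).
     (\<forall>a. p_m M s c a = q s a) \<and>
     (\<forall>a a' m. p_r M s c a m = p_r M s c a' m) \<and>
     (\<forall>a a' m. p_s M s c a m = p_s M s c a' m))"


subsection \<open>Trajectories\<close>

text \<open>The variables \<open>(S\<^sub>t, C\<^sub>t, A\<^sub>t, M\<^sub>t, R\<^sub>t)\<close> of one time step.\<close>

type_synonym ('s, 'c, 'a, 'm) step = "'s \<times> 'c \<times> 'a \<times> 'm \<times> real"

definition step_space :: "('s, 'c, 'a, 'm) m2dp \<Rightarrow> ('s, 'c, 'a, 'm) step measure" where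
  "step_space M = states M \<Otimes>\<^sub>M confs M \<Otimes>\<^sub>M count_space UNIV \<Otimes>\<^sub>M count_space UNIV \<Otimes>\<^sub>M borel"

fun state_of :: "('s, 'c, 'a, 'm) step \<Rightarrow> 's" where
  "state_of (s, c, a, m, r) = s"

fun action_of :: "('s, 'c, 'a, 'm) step \<Rightarrow> 'a" where
  "action_of (s, c, a, m, r) = a"

fun mediator_of :: "('s, 'c, 'a, 'm) step \<Rightarrow> 'm" where
  "mediator_of (s, c, a, m, r) = m"

fun reward_of :: "('s, 'c, 'a, 'm) step \<Rightarrow> real" where
  "reward_of (s, c, a, m, r) = r"

fun observed :: "('s, 'c, 'a, 'm) step \<Rightarrow> 's \<times> 'a \<times> 'm \<times> real" where
  "observed (s, c, a, m, r) = (s, a, m, r)"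

text \<open>The law of one time step from state \<open>s\<close> when the action is drawn from \<open>\<alpha> c\<close>.\<close>

definition step_law ::
    "('s, 'c, 'a, 'm) m2dp \<Rightarrow> 's \<Rightarrow> ('c \<Rightarrow> 'a pmf) \<Rightarrow> ('s, 'c, 'a, 'm) step measure" where
  "step_law M s \<alpha> = do {
     c \<leftarrow> p_c M s;
     a \<leftarrow> measure_pmf (\<alpha> c);
     m \<leftarrow> measure_pmf (p_m M s c a);
     r \<leftarrow> p_r M s c a m;
     return (step_space M) (s, c, a, m, r) }"

text \<open>The law of the next state given the current step.\<close>

fun next_state :: "('s, 'c, 'a, 'm) m2dp \<Rightarrow> ('s, 'c, 'a, 'm) step \<Rightarrow> 's measure" where
  "next_state M (s, c, a, m, r) = p_s M s c a m"

text \<open>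
  The observed history \<open>H\<^sub>t\<close> consists of the observed variables at times before \<open>t\<close>, an element of
  the product indexed by \<open>{0..<t}\<close>, and of \<open>S\<^sub>t\<close>. For \<open>t = 0\<close> the former is \<open>\<lambda>_. undefined\<close>.
\<close>

definition observed_history ::
    "nat \<Rightarrow> (nat \<Rightarrow> ('s, 'c, 'a, 'm) step) \<Rightarrow> (nat \<Rightarrow> 's \<times> 'a \<times> 'm \<times> real)" where
  "observed_history t \<omega> = (\<lambda>i\<in>{0..<t}. observed (\<omega> i))"

text \<open>
  The law on infinite trajectories (Ionescu-Tulcea) whose time-0 variables have law \<open>\<nu>\<close> and whose
  action at time \<open>t \<ge> 1\<close> is drawn from \<open>\<alpha> t h s c\<close>, where \<open>(h, s)\<close> is the observed history and \<open>c\<close>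
  the current confounder.
\<close>

definition trajectory_kernel ::
    "('s, 'c, 'a, 'm) m2dp \<Rightarrow> ('s, 'c, 'a, 'm) step measure
      \<Rightarrow> (nat \<Rightarrow> (nat \<Rightarrow> 's \<times> 'a \<times> 'm \<times> real) \<Rightarrow> 's \<Rightarrow> 'c \<Rightarrow> 'a pmf)
      \<Rightarrow> nat \<Rightarrow> (nat \<Rightarrow> ('s, 'c, 'a, 'm) step) \<Rightarrow> ('s, 'c, 'a, 'm) step measure" where
  "trajectory_kernel M \<nu> \<alpha> t \<omega> = (case t of
      0 \<Rightarrow> \<nu>
    | Suc t' \<Rightarrow> next_state M (\<omega> t') \<bind> (\<lambda>s. step_law M s (\<alpha> t (observed_history t \<omega>) s)))"

definition trajectory_law ::
    "('s, 'c, 'a, 'm) m2dp \<Rightarrow> ('s, 'c, 'a, 'm) step measure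
      \<Rightarrow> (nat \<Rightarrow> (nat \<Rightarrow> 's \<times> 'a \<times> 'm \<times> real) \<Rightarrow> 's \<Rightarrow> 'c \<Rightarrow> 'a pmf)
      \<Rightarrow> (nat \<Rightarrow> ('s, 'c, 'a, 'm) step) measure" where
  "trajectory_law M \<nu> \<alpha> =
     projective_family.lim UNIV
       (Ionescu_Tulcea.CI (trajectory_kernel M \<nu> \<alpha>) (\<lambda>_. step_space M)) (\<lambda>_. step_space M)"

definition offline :: "('s, 'c, 'a, 'm) m2dp \<Rightarrow> (nat \<Rightarrow> ('s, 'c, 'a, 'm) step) measure" where
  "offline M = trajectory_law M (init M \<bind> (\<lambda>s. step_law M s (p_a M s))) (\<lambda>t h s c. p_a M s c)"


subsection \<open>Policies and their returns\<close>

type_synonym ('s, 'a, 'm) policy = "nat \<Rightarrow> (nat \<Rightarrow> 's \<times> 'a \<times> 'm \<times> real) \<Rightarrow> 's \<Rightarrow> 'a pmf"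

definition policies :: "('s, 'c, 'a, 'm) m2dp \<Rightarrow> ('s, 'a, 'm) policy set" where
  "policies M = {\<pi>. \<forall>t a. (\<lambda>(h, s). pmf (\<pi> t h s) a) \<in> borel_measurable
     (Pi\<^sub>M {0..<t} (\<lambda>_. states M \<Otimes>\<^sub>M count_space UNIV \<Otimes>\<^sub>M count_space UNIV \<Otimes>\<^sub>M borel)
        \<Otimes>\<^sub>M states M)}"

definition det_stationary :: "('s \<Rightarrow> 'a) \<Rightarrow> ('s, 'a, 'm) policy" where
  "det_stationary f = (\<lambda>t h s. return_pmf (f s))"

definition online ::
    "('s, 'c, 'a, 'm) m2dp \<Rightarrow> ('s, 'a, 'm) policy
      \<Rightarrow> (nat \<Rightarrow> ('s, 'c, 'a, 'm) step) measure" where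
  "online M \<pi> = trajectory_law M
     (init M \<bind> (\<lambda>s. step_law M s (\<lambda>c. \<pi> 0 (\<lambda>_. undefined) s)))
     (\<lambda>t h s c. \<pi> t h s)"

definition discounted_return ::
    "('s, 'c, 'a, 'm) m2dp \<Rightarrow> (nat \<Rightarrow> ('s, 'c, 'a, 'm) step) measure \<Rightarrow> real" where
  "discounted_return M P = (\<Sum>t. discount M ^ t * (\<integral>\<omega>. reward_of (\<omega> t) \<partial>P))"

definition J :: "('s, 'c, 'a, 'm) m2dp \<Rightarrow> ('s, 'a, 'm) policy \<Rightarrow> real" where
  "J M \<pi> = discounted_return M (online M \<pi>)"

definition optimal :: "('s, 'c, 'a, 'm) m2dp \<Rightarrow> ('s \<Rightarrow> 'a) \<Rightarrow> bool" where
  "optimal M f \<longleftrightarrow> f \<in> states M \<rightarrow>\<^sub>M count_space UNIV \<and>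
     (\<forall>\<pi>\<in>policies M. J M \<pi> \<le> J M (det_stationary f))"

text \<open>The same model started in the fixed state \<open>s\<close>.\<close>

definition started_in ::
    "('s, 'c, 'a, 'm) m2dp \<Rightarrow> 's \<Rightarrow> ('s, 'c, 'a, 'm) m2dp" where
  "started_in M s = M\<lparr>init := return (states M) s\<rparr>"


subsection \<open>The mediated Q-function\<close>

text \<open>\<open>P(A\<^sub>t = a | S\<^sub>t = s)\<close> and \<open>P(A\<^sub>t = a, M\<^sub>t = m | S\<^sub>t = s)\<close> under the offline law.\<close>

definition p_b :: "('s, 'c, 'a, 'm) m2dp \<Rightarrow> 's \<Rightarrow> 'a \<Rightarrow> real" where
  "p_b M s a = (\<integral>c. pmf (p_a M s c) a \<partial>p_c M s)"

definition p_am :: "('s, 'c, 'a, 'm) m2dp \<Rightarrow> 's \<Rightarrow> 'a \<Rightarrow> 'm \<Rightarrow> real" where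
  "p_am M s a m = (\<integral>c. pmf (p_a M s c) a * pmf (p_m M s c a) m \<partial>p_c M s)"

text \<open>
  The offline conditional law of \<open>C\<^sub>t\<close> given \<open>(S\<^sub>t, A\<^sub>t, M\<^sub>t) = (s, a, m)\<close>, by Bayes' rule. Where
  \<open>(a, m)\<close> has probability 0 given \<open>s\<close>, a version of the conditional law has to be chosen: we then
  condition on \<open>(s, a)\<close> only, and on \<open>s\<close> only if \<open>a\<close> has probability 0 as well. The middle case
  matters: without overlap of the mediator laws of different actions, the weight
  \<open>p\<^sub>m(m|s,a) p\<^sub>b(b|s)\<close> may be positive although \<open>p\<^sub>m(m|s,b) = 0\<close>.
\<close>

definition conf_given :: "('s, 'c, 'a, 'm) m2dp \<Rightarrow> 's \<Rightarrow> 'a \<Rightarrow> 'm \<Rightarrow> 'c measure" where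
  "conf_given M s a m =
     (if p_am M s a m > 0 then
        density (p_c M s) (\<lambda>c. ennreal (pmf (p_a M s c) a * pmf (p_m M s c a) m / p_am M s a m))
      else if p_b M s a > 0 then
        density (p_c M s) (\<lambda>c. ennreal (pmf (p_a M s c) a / p_b M s a))
      else p_c M s)"

definition step_given ::
    "('s, 'c, 'a, 'm) m2dp \<Rightarrow> 's \<Rightarrow> 'a \<Rightarrow> 'm \<Rightarrow> ('s, 'c, 'a, 'm) step measure" where
  "step_given M s a m = do {
     c \<leftarrow> conf_given M s a m;
     r \<leftarrow> p_r M s c a m;
     return (step_space M) (s, c, a, m, r) }"

text \<open>The policy acts from time 1 on; the first step has its offline conditional law.\<close>

definition Q :: "('s, 'c, 'a, 'm) m2dp \<Rightarrow> ('s, 'a, 'm) policy \<Rightarrow> 's \<Rightarrow> 'a \<Rightarrow> 'm \<Rightarrow> real" where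
  "Q M \<pi> s a m =
     discounted_return M (trajectory_law M (step_given M s a m) (\<lambda>t h s c. \<pi> t h s))"

definition Q_opt :: "('s, 'c, 'a, 'm) m2dp \<Rightarrow> 's \<Rightarrow> 'a \<Rightarrow> 'm \<Rightarrow> real" where
  "Q_opt M s a m = (SUP \<pi>\<in>policies M. Q M \<pi> s a m)"

text \<open>The weighted average of the mediated optimal Q-function that defines greedy actions.\<close>

definition weighted_Q ::
    "('s, 'c, 'a::finite, 'm::finite) m2dp \<Rightarrow> ('s \<Rightarrow> 'a \<Rightarrow> 'm pmf) \<Rightarrow> 's \<Rightarrow> 'a \<Rightarrow> real" where
  "weighted_Q M q s a = (\<Sum>b\<in>UNIV. \<Sum>m\<in>UNIV. pmf (q s a) m * p_b M s b * Q_opt M s b m)"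

abbreviation greedy ::
    "('s, 'c, 'a::finite, 'm::finite) m2dp \<Rightarrow> ('s \<Rightarrow> 'a \<Rightarrow> 'm pmf) \<Rightarrow> 's \<Rightarrow> 'a \<Rightarrow> bool" where
  "greedy M q s a \<equiv> is_arg_max (weighted_Q M q s) (\<lambda>_. True) a"

text \<open>The sigma-algebra on trajectories generated by \<open>(S\<^sub>t, A\<^sub>t, M\<^sub>t)\<close>.\<close>

definition sigma_SAM ::
    "('s, 'c, 'a, 'm) m2dp \<Rightarrow> nat \<Rightarrow> (nat \<Rightarrow> ('s, 'c, 'a, 'm) step) measure" where
  "sigma_SAM M t = vimage_algebra (space (offline M))
     (\<lambda>\<omega>. (state_of (\<omega> t), action_of (\<omega> t), mediator_of (\<omega> t)))
     (states M \<Otimes>\<^sub>M count_space UNIV \<Otimes>\<^sub>M count_space UNIV)"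

end

theory Submission
  imports Defs
begin

text \<open>
  Under the front-door criterion the online process is a Markov decision process whose
  action values for a continuation value \<open>v\<close> are averages of \<open>one_step v s c a m\<close> over
  \<open>p_m(m|s,a)\<close> and \<open>p_c(c|s)\<close>. Let \<open>opt_value\<close> be the fixed point of its Bellman operator, a
  contraction. Telescoping \<open>\<gamma>\<^sup>t E opt_value (S\<^sub>t)\<close> along the trajectory of an arbitrary
  history-dependent policy writes its return as \<open>E opt_value (S\<^sub>0)\<close> minus the discounted sum of
  the expected gaps between \<open>opt_value (S\<^sub>t)\<close> and the action value of the policy. The gaps are
  nonnegative and vanish exactly for greedy actions, which gives optimality and uniqueness.
  Applied from time 1 on, the same identity yields
  \<open>Q\<^sup>*(s,a,m) = E (one_step opt_value s C a m | s, a, m)\<close>. Since \<open>one_step\<close> does not depend on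
  \<open>a\<close>, averaging over \<open>p\<^sub>b\<close> undoes the conditioning of \<open>C\<close> on the action, so the weighted average
  of \<open>Q\<^sup>*\<close> is the action value of \<open>opt_value\<close>; the Bellman equation is then Bayes' rule.
\<close>

section \<open>Kernels and bounded integrals\<close>

text \<open>All facts about trajectories come from one disintegration formula for integrals of
  bounded functions of the past and the current step. This is why rewards, which are bounded only
  almost surely, are truncated, and why null events are expressed by vanishing integrals of
  indicators. History-dependent policies need no reduction to Markov ones: the gap at time
  \<open>t\<close> depends on the history only through the state and the weights that the policy
  puts on actions, and is nonnegative whatever these weights are.

  Two obstacles shape the rest. Optimality for one initial law constrains a policy only at almost
  all visited states, and only at times with \<open>discount M ^ t > 0\<close>; pointwise uniqueness
  therefore starts the model in every single state, where the gap at time 0 is decisive. And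
  \<open>Q_opt M s b m\<close> enters the weighted average also at pairs \<open>(b, m)\<close> of
  probability zero given \<open>s\<close>; the identity for \<open>p_b M s b * Q_opt M s b m\<close>
  then rests on the version of the conditional law fixed in \<open>conf_given\<close>, where an
  impossible mediator leaves the conditioning on the action in force.\<close>

lemma measurable_pmf_kernel:
  fixes f :: "'x \<Rightarrow> 'a::finite pmf"
  assumes [measurable]: "\<And>a. (\<lambda>x. pmf (f x) a) \<in> borel_measurable N"
  shows "(\<lambda>x. measure_pmf (f x)) \<in> N \<rightarrow>\<^sub>M prob_algebra (count_space UNIV)"
proof (intro measurable_prob_algebraI measurable_subprob_algebra)
  fix A :: "'a set"
  \<comment> \<open>On a finite type the mass of any set is a finite sum of point masses, and these
    are the quantities whose measurability the model provides.\<close>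
  have "(\<lambda>x. ennreal (\<Sum>a\<in>A. pmf (f x) a)) \<in> borel_measurable N"
    by measurable
  then show "(\<lambda>x. emeasure (measure_pmf (f x)) A) \<in> borel_measurable N"
    by (simp add: emeasure_measure_pmf_finite sum_nonneg)
qed (auto intro: measure_pmf.prob_space_axioms measure_pmf.subprob_space_axioms)

text \<open>Pushing \<open>K x\<close> forward along \<open>y \<mapsto> (x, y)\<close> moves the
  parameter from the integrand into the measure; the integral of the fixed function
  \<open>case_prod f\<close> against a kernel is measurable.\<close>

lemma measurable_integral_kernel:
  fixes f :: "'x \<Rightarrow> 'y \<Rightarrow> real"
  assumes f [measurable]: "(\<lambda>(x, y). f x y) \<in> borel_measurable (N \<Otimes>\<^sub>M L)"
    and K: "K \<in> N \<rightarrow>\<^sub>M prob_algebra L"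
  shows "(\<lambda>x. \<integral>y. f x y \<partial>K x) \<in> borel_measurable N"
proof -
  have K' [measurable]: "K \<in> N \<rightarrow>\<^sub>M subprob_algebra L"
    using K by (rule measurable_prob_algebraD)
  have "(\<lambda>x. \<integral>z. case_prod f z \<partial>distr (K x) (N \<Otimes>\<^sub>M L) (\<lambda>y. (x, y))) \<in> borel_measurable N"
    by (rule measurable_compose[OF measurable_distr2[OF _ K'] integral_measurable_subprob_algebra[OF f]])
      measurable
  also have "?this \<longleftrightarrow> ?thesis"
    by (intro measurable_cong, subst integral_distr)
      (auto simp: measurable_cong_sets[OF sets_kernel[OF K'] refl])
  finally show ?thesis .
qed

lemma abs_integral_le_bound:
  fixes f :: "'x \<Rightarrow> real"
  assumes "prob_space N" and "\<And>x. x \<in> space N \<Longrightarrow> \<bar>f x\<bar> \<le> B"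
  shows "\<bar>\<integral>x. f x \<partial>N\<bar> \<le> B"
proof -
  interpret prob_space N by fact
  \<comment> \<open>A probability space is nonempty, so the pointwise bound forces
    \<open>0 \<le> B\<close>. This settles the non-integrable case, in which the integral is 0 by
    convention.\<close>
  have B: "0 \<le> B"
    using assms(2) not_empty abs_ge_zero order_trans by blast
  show ?thesis
  proof (cases "integrable N f")
    case True
    then have "\<bar>\<integral>x. f x \<partial>N\<bar> \<le> (\<integral>x. \<bar>f x\<bar> \<partial>N)"
      by (intro integral_abs_bound)
    also have "\<dots> \<le> (\<integral>x. B \<partial>N)"
      using True assms(2) by (intro integral_mono) auto
    finally show ?thesis by (simp add: prob_space)
  qed (use B in \<open>simp add: not_integrable_integral_eq\<close>)
qed

lemma integrable_bounded:
  fixes f :: "'x \<Rightarrow> real"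
  assumes "prob_space N" "f \<in> borel_measurable N" and "\<And>x. x \<in> space N \<Longrightarrow> \<bar>f x\<bar> \<le> B"
  shows "integrable N f"
proof -
  interpret prob_space N by fact
  show ?thesis
    by (rule integrable_const_bound[of _ B]) (use assms in auto)
qed

lemma integral_bind_prob_algebra:
  fixes f :: "'y \<Rightarrow> real"
  assumes N: "N \<in> space (prob_algebra S)" and K: "K \<in> S \<rightarrow>\<^sub>M prob_algebra L"
    and f: "f \<in> borel_measurable L" "\<And>y. y \<in> space L \<Longrightarrow> \<bar>f y\<bar> \<le> B"
  shows "(\<integral>y. f y \<partial>(N \<bind> K)) = (\<integral>x. \<integral>y. f y \<partial>K x \<partial>N)"
proof (rule integral_bind[where K=L and B=B and B'=1])
  from N interpret prob_space N by (simp add: space_prob_algebra)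
  have "sets N = sets S" using N by (simp add: space_prob_algebra)
  then show *: "K \<in> N \<rightarrow>\<^sub>M subprob_algebra L"
    using K by (auto intro!: measurable_prob_algebraD cong: measurable_cong_sets)
  show "finite_measure N" by (rule finite_measure_axioms)
  show "AE x in N. emeasure (K x) (space (K x)) \<le> ennreal 1"
    using subprob_space_kernel[OF *] by (auto simp: subprob_space.emeasure_space_le_1)
qed (use f in auto)

lemma integral_pmf_finite:
  fixes p :: "'a::finite pmf" and f :: "'a \<Rightarrow> real"
  shows "(\<integral>a. f a \<partial>measure_pmf p) = (\<Sum>a\<in>UNIV. pmf p a * f a)"
  by (simp add: integral_measure_pmf[of UNIV])

text \<open>With \<open>d t\<close> the temporal difference of \<open>u\<close>, the term
  \<open>g ^ t * d t\<close> is \<open>g ^ t * u t - g ^ Suc t * u (Suc t)\<close> minus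
  \<open>g ^ t * r t\<close>. The first part telescopes to \<open>u 0\<close> because
  \<open>u\<close> is bounded and \<open>g < 1\<close>. Here \<open>r\<close> will be expected
  rewards and \<open>u\<close> expected values, so the discounted sum of \<open>d\<close> measures
  the loss against \<open>u 0\<close>.\<close>

lemma discounted_telescope:
  fixes r u d :: "nat \<Rightarrow> real"
  assumes g: "0 \<le> g" "g < 1" and r: "\<And>t. \<bar>r t\<bar> \<le> B" and u: "\<And>t. \<bar>u t\<bar> \<le> B"
    and d: "\<And>t. d t = u t - (r t + g * u (Suc t))"
  shows "summable (\<lambda>t. g ^ t * d t)" and "(\<Sum>t. g ^ t * r t) = u 0 - (\<Sum>t. g ^ t * d t)"
proof -
  have B: "summable (\<lambda>t. g ^ t * B)"
    using g by (intro summable_mult2 summable_geometric) auto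
  have r': "summable (\<lambda>t. g ^ t * r t)" 
    by (rule summable_comparison_test'[OF B]) (use r g in \<open>simp add: abs_mult mult_left_mono\<close>)
  have "(\<lambda>t. g ^ t * B) \<longlonglongrightarrow> 0" using B by (rule summable_LIMSEQ_zero)
  then have u0: "(\<lambda>t. g ^ t * u t) \<longlonglongrightarrow> 0"
    by (rule Lim_null_comparison[OF always_eventually, rotated])
      (use u g in \<open>simp add: abs_mult mult_left_mono\<close>)
  have *: "(\<lambda>t. g ^ t * u t - g ^ Suc t * u (Suc t)) sums (u 0 - 0)"
    using telescope_sums'[OF u0] by simp
  have "(\<lambda>t. g ^ t * d t) sums (u 0 - (\<Sum>t. g ^ t * r t))"
    using sums_diff[OF * summable_sums[OF r']] by (simp add: d algebra_simps)
  then show "summable (\<lambda>t. g ^ t * d t)" and "(\<Sum>t. g ^ t * r t) = u 0 - (\<Sum>t. g ^ t * d t)"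
    by (simp_all add: sums_iff)
qed

lemma measurable_countable_param:
  assumes "\<And>i::'i::countable. F i \<in> X \<rightarrow>\<^sub>M N"
  shows "(\<lambda>(x, i). F i x) \<in> X \<Otimes>\<^sub>M count_space UNIV \<rightarrow>\<^sub>M N"
  unfolding case_prod_beta
  by (rule measurable_compose_countable[where g=snd]) (auto intro: measurable_compose[OF measurable_fst assms])

lemma sum_pmf_UNIV [simp]: "(\<Sum>a\<in>UNIV. pmf (p :: 'a::finite pmf) a) = 1"
  by (rule sum_pmf_eq_1) auto

lemma sum_pmf_mult_const [simp]: "(\<Sum>a\<in>UNIV. pmf (p :: 'a::finite pmf) a * x) = x"
  by (simp flip: sum_distrib_right)

text \<open>The maximum is 1-Lipschitz for the sup distance, which is why maximizing over actions
  does not destroy the contraction.\<close>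

lemma abs_Max_diff_le:
  fixes f g :: "'a::finite \<Rightarrow> real"
  assumes "\<And>a. \<bar>f a - g a\<bar> \<le> d"
  shows "\<bar>(MAX a. f a) - (MAX a. g a)\<bar> \<le> d"
proof -
  have le: "(MAX a. f a) \<le> (MAX a. g a) + d" if "\<And>a. \<bar>f a - g a\<bar> \<le> d" for f g :: "'a \<Rightarrow> real"
  proof (rule Max.boundedI)
    fix x assume "x \<in> range f"
    then obtain a where "x = f a" by auto
    moreover have "g a \<le> (MAX a. g a)" by (rule Max_ge) auto
    ultimately show "x \<le> (MAX a. g a) + d"
      using that[of a] by linarith
  qed auto
  have "\<bar>g a - f a\<bar> \<le> d" for a
    using assms[of a] by (simp add: abs_minus_commute)
  from le[of f g, OF assms] le[of g f, OF this] show ?thesis by linarith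
qed

lemma measurable_Max_UNIV:
  fixes f :: "'a::finite \<Rightarrow> 'x \<Rightarrow> real"
  assumes "\<And>a. f a \<in> borel_measurable N"
  shows "(\<lambda>x. MAX a. f a x) \<in> borel_measurable N"
  using assms by (intro borel_measurable_Max) auto

lemma abs_sum_pmf_le:
  fixes p :: "'a::finite pmf" and f :: "'a \<Rightarrow> real"
  assumes "\<And>a. \<bar>f a\<bar> \<le> d"
  shows "\<bar>\<Sum>a\<in>UNIV. pmf p a * f a\<bar> \<le> d"
proof -
  have "\<bar>\<Sum>a\<in>UNIV. pmf p a * f a\<bar> \<le> (\<Sum>a\<in>UNIV. pmf p a * d)"
    using assms by (intro sum_abs[THEN order_trans] sum_mono) (simp add: abs_mult mult_left_mono)
  then show ?thesis by simp
qed

lemma sum_pmf_return: "(\<Sum>a\<in>UNIV. pmf (return_pmf x) a * f a) = (f (x :: 'a::finite) :: real)"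
  using integral_pmf_finite[of "return_pmf x" f] by simp

text \<open>Common form of the two Bayes densities in \<open>conf_given\<close>: a weight
  \<open>g\<close> with values in [0,1] and positive mean \<open>I\<close>. The integral formula is
  the quotient form of a conditional expectation.\<close>

lemma prob_space_normalized_density:
  fixes g :: "'x \<Rightarrow> real"
  assumes N: "prob_space N" and g [measurable]: "g \<in> borel_measurable N"
    and "\<And>x. 0 \<le> g x" "\<And>x. g x \<le> 1" and I: "I = (\<integral>x. g x \<partial>N)" "0 < I"
  shows "prob_space (density N (\<lambda>x. ennreal (g x / I)))"
    and "f \<in> borel_measurable N \<Longrightarrow>
      (\<integral>x. f x \<partial>density N (\<lambda>x. ennreal (g x / I))) = (\<integral>x. g x * f x \<partial>N) / (I :: real)"
proof -
  have "integrable N g"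
    using assms by (intro integrable_bounded[OF N g, where B=1]) (simp add: abs_le_iff order_trans[of "- g _" 0])
  then have "(\<integral>\<^sup>+x. ennreal (g x / I) \<partial>N) = ennreal (\<integral>x. g x / I \<partial>N)"
    using assms by (intro nn_integral_eq_integral) auto
  also have "\<dots> = 1" using I by simp
  finally show "prob_space (density N (\<lambda>x. ennreal (g x / I)))"
    by (intro prob_spaceI) (simp add: emeasure_density cong: nn_integral_cong)
  show "(\<integral>x. f x \<partial>density N (\<lambda>x. ennreal (g x / I))) = (\<integral>x. g x * f x \<partial>N) / (I :: real)"
    if "f \<in> borel_measurable N"
    using assms that by (subst integral_density) auto
qed

section \<open>Trajectories\<close>

context Ionescu_Tulcea
begin

text \<open>\<open>CI\<close> on an index set restricts the finite-horizon measure \<open>C\<close>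
  that reaches up to a bound of that set; for an initial segment the bound is \<open>n\<close> and
  the restriction changes nothing.\<close>

lemma CI_atLeast0LessThan: "CI {0..<n} = C 0 n (\<lambda>_. undefined)"
proof -
  have *: "up_to {0..<n} = n"
  proof (rule antisym)
    show "up_to {0..<n} \<le> n" by (simp add: up_to_iff)
    show "n \<le> up_to {0..<n}" using up_to_less[of "{0..<n}" "n - 1"] by (cases n) auto
  qed
  have "distr (C 0 n (\<lambda>_. undefined)) (PiM {0..<n} M) (\<lambda>f. restrict f {0..<n}) = C 0 n (\<lambda>_. undefined)"
    using distr_C[of n n "\<lambda>_. undefined" 0] by simp
  then show ?thesis by (simp add: CI_def *)
qed

lemma distr_lim_restrict: "distr PF.lim (PiM {0..<n} M) (\<lambda>\<omega>. restrict \<omega> {0..<n}) = C 0 n (\<lambda>_. undefined)"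
  by (simp add: distr_lim CI_atLeast0LessThan)

text \<open>The total mass can be read off from any marginal; the one on the empty index set is
  \<open>C 0 0\<close>.\<close>

lemma prob_space_lim: "prob_space PF.lim"
proof (rule prob_space_distrD[of "\<lambda>\<omega>. restrict \<omega> {}" _ "PiM {} M"])
  show "(\<lambda>\<omega>. restrict \<omega> {}) \<in> PF.lim \<rightarrow>\<^sub>M PiM {} M"
    by (auto simp: measurable_cong_sets[OF PF.sets_lim])
  show "prob_space (distr PF.lim (PiM {} M) (\<lambda>\<omega>. restrict \<omega> {}))"
    using prob_space_C[of "\<lambda>_. undefined" 0 0] distr_lim_restrict[of 0] by simp
qed

text \<open>Source of all later facts about trajectories: \<open>P n\<close> acts as the conditional
  law of coordinate \<open>n\<close> given its past. The marginal on the first \<open>n + 1\<close>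
  coordinates is \<open>C 0 n\<close> followed by \<open>eP n\<close>, which appends one coordinate
  drawn from \<open>P n\<close>.\<close>

lemma integral_lim_step:
  fixes f :: "(nat \<Rightarrow> 'a) \<times> 'a \<Rightarrow> real"
  assumes f [measurable]: "f \<in> borel_measurable (PiM {0..<n} M \<Otimes>\<^sub>M M n)"
    and B: "\<And>z. z \<in> space (PiM {0..<n} M \<Otimes>\<^sub>M M n) \<Longrightarrow> \<bar>f z\<bar> \<le> B"
  shows "(\<integral>\<omega>. f (restrict \<omega> {0..<n}, \<omega> n) \<partial>PF.lim) =
    (\<integral>\<omega>. \<integral>x. f (restrict \<omega> {0..<n}, x) \<partial>P n (restrict \<omega> {0..<n}) \<partial>PF.lim)"
proof -
  let ?g = "\<lambda>\<omega>. f (restrict \<omega> {0..<n}, \<omega> n)" and ?u = "\<lambda>_::nat. undefined :: 'a"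
  have PP: "P n \<in> PiM {0..<n} M \<rightarrow>\<^sub>M prob_algebra (M n)"
    by (rule measurable_prob_algebraI[OF prob_space_P]) (auto intro: P)
  have eP: "eP n \<in> PiM {0..<n} M \<rightarrow>\<^sub>M prob_algebra (PiM {0..<Suc n} M)"
    by (intro measurable_prob_algebraI prob_space_eP) auto
  have g [measurable]: "?g \<in> borel_measurable (PiM {0..<Suc n} M)"
    by measurable
  have gB: "\<bar>?g \<omega>\<bar> \<le> B" if "\<omega> \<in> space (PiM {0..<Suc n} M)" for \<omega>
    using that by (intro B) (auto simp: space_pair_measure space_PiM PiE_iff)
  have C: "C 0 n ?u \<in> space (prob_algebra (PiM {0..<n} M))"
    by (simp add: space_prob_algebra prob_space_C sets_C)
  have res [measurable]: "(\<lambda>\<omega>. restrict \<omega> {0..<k}) \<in> PF.lim \<rightarrow>\<^sub>M PiM {0..<k} M" for k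
    by (subst measurable_cong_sets[OF PF.sets_lim refl]) (auto intro: measurable_restrict_subset)
  have h: "(\<lambda>\<omega>. \<integral>x. f (\<omega>, x) \<partial>P n \<omega>) \<in> borel_measurable (PiM {0..<n} M)"
    by (rule measurable_integral_kernel[OF _ PP]) simp
  have "(\<integral>\<omega>. ?g \<omega> \<partial>PF.lim) = (\<integral>\<omega>. ?g (restrict \<omega> {0..<Suc n}) \<partial>PF.lim)"
    by (simp add: Int_absorb2 Int_absorb1)
  also have "\<dots> = (\<integral>\<omega>. ?g \<omega> \<partial>C 0 (Suc n) ?u)"
    unfolding distr_lim_restrict[symmetric] by (rule integral_distr[symmetric, OF res g])
  also have "\<dots> = (\<integral>\<omega>. \<integral>\<omega>'. ?g \<omega>' \<partial>eP n \<omega> \<partial>C 0 n ?u)"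
    using integral_bind_prob_algebra[OF C eP g gB] by simp
  also have "\<dots> = (\<integral>\<omega>. \<integral>x. f (\<omega>, x) \<partial>P n \<omega> \<partial>C 0 n ?u)"
  proof (intro Bochner_Integration.integral_cong refl)
    fix \<omega> assume "\<omega> \<in> space (C 0 n ?u)"
    then have w: "\<omega> \<in> space (PiM {0..<n} M)" by (simp add: space_C)
    have upd: "fun_upd \<omega> n \<in> P n \<omega> \<rightarrow>\<^sub>M PiM {0..<Suc n} M"
      using w by (intro measurable_fun_upd[where J="{0..<n}"]) auto
    \<comment> \<open>Points of \<open>PiM {0..<n} M\<close> are extensional, so forgetting the
      appended coordinate gives back \<open>\<omega>\<close> exactly.\<close>
    have "restrict (fun_upd \<omega> n x) {0..<n} = \<omega>" for x
      using w by (auto simp: space_PiM PiE_def extensional_def)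
    then show "(\<integral>\<omega>'. ?g \<omega>' \<partial>eP n \<omega>) = (\<integral>x. f (\<omega>, x) \<partial>P n \<omega>)"
      unfolding eP_def by (subst integral_distr[OF upd g]) simp
  qed
  also have "\<dots> = (\<integral>\<omega>. \<integral>x. f (restrict \<omega> {0..<n}, x) \<partial>P n (restrict \<omega> {0..<n}) \<partial>PF.lim)"
    unfolding distr_lim_restrict[symmetric] by (rule integral_distr[OF res h])
  finally show ?thesis .
qed

end

text \<open>The projections are defined by pattern matching; written with \<open>fst\<close> and
  \<open>snd\<close> they fall under the measurability rules for products.\<close>

lemma state_of_eq: "state_of = fst"
  and action_of_eq: "action_of = (\<lambda>x. fst (snd (snd x)))"
  and mediator_of_eq: "mediator_of = (\<lambda>x. fst (snd (snd (snd x))))"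
  and reward_of_eq: "reward_of = (\<lambda>x. snd (snd (snd (snd x))))"
  and observed_eq: "observed = (\<lambda>x. (fst x, snd (snd x)))"
  by (auto simp: fun_eq_iff)

lemma measurable_step_components [measurable]:
  fixes M :: "('s, 'c, 'a, 'm) m2dp"
  shows "state_of \<in> step_space M \<rightarrow>\<^sub>M states M"
    and "action_of \<in> step_space M \<rightarrow>\<^sub>M count_space UNIV"
    and "mediator_of \<in> step_space M \<rightarrow>\<^sub>M count_space UNIV"
    and "reward_of \<in> step_space M \<rightarrow>\<^sub>M borel"
    and "observed \<in> step_space M \<rightarrow>\<^sub>M states M \<Otimes>\<^sub>M count_space UNIV \<Otimes>\<^sub>M count_space UNIV \<Otimes>\<^sub>M borel"
  by (simp_all add: step_space_def state_of_eq action_of_eq mediator_of_eq reward_of_eq observed_eq)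

abbreviation history_space ::
    "('s, 'c, 'a, 'm) m2dp \<Rightarrow> nat \<Rightarrow> (nat \<Rightarrow> 's \<times> 'a \<times> 'm \<times> real) measure" where
  "history_space M t \<equiv> Pi\<^sub>M {0..<t} (\<lambda>_. states M \<Otimes>\<^sub>M count_space UNIV \<Otimes>\<^sub>M count_space UNIV \<Otimes>\<^sub>M borel)"

lemma measurable_observed_history:
  "{0..<t} \<subseteq> I \<Longrightarrow> observed_history t \<in> Pi\<^sub>M I (\<lambda>_. step_space M) \<rightarrow>\<^sub>M history_space M t"
  unfolding observed_history_def
  by (intro measurable_restrict measurable_compose[OF measurable_component_singleton]
      measurable_step_components) auto

lemma observed_history_0 [simp]: "observed_history 0 \<omega> = (\<lambda>_. undefined)"
  by (simp add: observed_history_def restrict_def)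

text \<open>The kernel at time \<open>t\<close> receives only the restricted past; this lets the
  control be evaluated on the whole trajectory.\<close>

lemma observed_history_restrict [simp]: "observed_history t (restrict \<omega> {0..<t}) = observed_history t \<omega>"
  by (auto simp: observed_history_def restrict_def)

section \<open>The law of one step as a composition of kernels\<close>

context m2dp_model
begin

declare p_a [measurable] p_m [measurable] p_c [measurable]

text \<open>This and the next two definitions are the layers of \<open>step_law\<close>, from the
  innermost outwards, as functions of the variables already drawn. Each layer is shown to be a
  kernel on top of the previous one; \<open>reward_law\<close> is also the last layer of
  \<open>step_given\<close>.\<close>

definition reward_law :: "'a \<Rightarrow> 'm \<Rightarrow> 's \<Rightarrow> 'c \<Rightarrow> ('s, 'c, 'a, 'm) step measure" where
  "reward_law a m s c = p_r M s c a m \<bind> (\<lambda>r. return (step_space M) (s, c, a, m, r))"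

definition mediator_law :: "'a \<Rightarrow> 's \<Rightarrow> 'c \<Rightarrow> ('s, 'c, 'a, 'm) step measure" where
  "mediator_law a s c = measure_pmf (p_m M s c a) \<bind> (\<lambda>m. reward_law a m s c)"

definition action_law :: "'s \<Rightarrow> ('c \<Rightarrow> 'a pmf) \<Rightarrow> 'c \<Rightarrow> ('s, 'c, 'a, 'm) step measure" where
  "action_law s \<beta> c = measure_pmf (\<beta> c) \<bind> (\<lambda>a. mediator_law a s c)"

lemma step_law_eq: "step_law M s \<beta> = p_c M s \<bind> action_law s \<beta>"
  by (simp add: step_law_def action_law_def[abs_def] mediator_law_def reward_law_def)

lemma step_given_eq: "step_given M s a m = conf_given M s a m \<bind> reward_law a m s"
  by (simp add: step_given_def reward_law_def[abs_def])

lemma return_step_kernel: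
  "(\<lambda>((s, c), r). return (step_space M) (s, c, a, m, r)) \<in>
    (states M \<Otimes>\<^sub>M confs M) \<Otimes>\<^sub>M borel \<rightarrow>\<^sub>M prob_algebra (step_space M)"
  unfolding case_prod_beta
  by (rule measurable_compose[OF _ measurable_return_prob_space]) (simp add: step_space_def)

lemma reward_law_kernel:
  "(\<lambda>(s, c). reward_law a m s c) \<in> states M \<Otimes>\<^sub>M confs M \<rightarrow>\<^sub>M prob_algebra (step_space M)"
proof -
  have "(\<lambda>x. p_r M (fst x) (snd x) a m \<bind> (\<lambda>r. return (step_space M) (fst x, snd x, a, m, r)))
      \<in> states M \<Otimes>\<^sub>M confs M \<rightarrow>\<^sub>M prob_algebra (step_space M)"
    by (rule measurable_bind_prob_space2[OF p_r[unfolded case_prod_beta]])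
      (use return_step_kernel in \<open>simp add: case_prod_beta'\<close>)
  then show ?thesis by (simp add: reward_law_def case_prod_beta)
qed

lemma mediator_law_kernel:
  "(\<lambda>(s, c). mediator_law a s c) \<in> states M \<Otimes>\<^sub>M confs M \<rightarrow>\<^sub>M prob_algebra (step_space M)"
proof -
  have "(\<lambda>x. measure_pmf (p_m M (fst x) (snd x) a) \<bind> (\<lambda>m. reward_law a m (fst x) (snd x)))
      \<in> states M \<Otimes>\<^sub>M confs M \<rightarrow>\<^sub>M prob_algebra (step_space M)"
  proof (rule measurable_bind_prob_space2[OF measurable_pmf_kernel])
    show "(\<lambda>(x, m). reward_law a m (fst x) (snd x))
        \<in> (states M \<Otimes>\<^sub>M confs M) \<Otimes>\<^sub>M count_space UNIV \<rightarrow>\<^sub>M prob_algebra (step_space M)"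
      using reward_law_kernel[of a] unfolding case_prod_beta[abs_def]
      by (intro measurable_countable_param[unfolded case_prod_beta[abs_def]])
    show "(\<lambda>x. pmf (p_m M (fst x) (snd x) a) m) \<in> borel_measurable (states M \<Otimes>\<^sub>M confs M)" for m
      using p_m[of a m] by (simp add: case_prod_beta)
  qed
  then show ?thesis by (simp add: mediator_law_def case_prod_beta)
qed

text \<open>The parameter space \<open>X\<close> is kept general because the control may depend on
  more than the state: \<open>X\<close> will be the state space for the first step of the online and
  offline laws, and its product with the history space for a general control.\<close>

lemma action_law_kernel:
  assumes f: "f \<in> X \<rightarrow>\<^sub>M states M"
    and \<beta>: "\<And>a. (\<lambda>(x, c). pmf (\<beta> x c) a) \<in> borel_measurable (X \<Otimes>\<^sub>M confs M)"
  shows "(\<lambda>(x, c). action_law (f x) (\<beta> x) c) \<in> X \<Otimes>\<^sub>M confs M \<rightarrow>\<^sub>M prob_algebra (step_space M)"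
proof -
  have "(\<lambda>y. measure_pmf (\<beta> (fst y) (snd y)) \<bind> (\<lambda>a. mediator_law a (f (fst y)) (snd y)))
      \<in> X \<Otimes>\<^sub>M confs M \<rightarrow>\<^sub>M prob_algebra (step_space M)"
  proof (rule measurable_bind_prob_space2[OF measurable_pmf_kernel])
    have *: "(\<lambda>y. (f (fst y), snd y)) \<in> X \<Otimes>\<^sub>M confs M \<rightarrow>\<^sub>M states M \<Otimes>\<^sub>M confs M"
      using f by measurable
    have "(\<lambda>y. mediator_law a (f (fst y)) (snd y)) \<in> X \<Otimes>\<^sub>M confs M \<rightarrow>\<^sub>M prob_algebra (step_space M)" for a
      using measurable_compose[OF * mediator_law_kernel[of a]] by simp
    then show "(\<lambda>(y, a). mediator_law a (f (fst y)) (snd y))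
        \<in> (X \<Otimes>\<^sub>M confs M) \<Otimes>\<^sub>M count_space UNIV \<rightarrow>\<^sub>M prob_algebra (step_space M)"
      by (rule measurable_countable_param)
    show "(\<lambda>y. pmf (\<beta> (fst y) (snd y)) a) \<in> borel_measurable (X \<Otimes>\<^sub>M confs M)" for a
      using \<beta>[of a] by (simp add: case_prod_beta)
  qed
  then show ?thesis by (simp add: action_law_def case_prod_beta)
qed

lemma step_law_kernel:
  assumes f: "f \<in> X \<rightarrow>\<^sub>M states M"
    and \<beta>: "\<And>a. (\<lambda>(x, c). pmf (\<beta> x c) a) \<in> borel_measurable (X \<Otimes>\<^sub>M confs M)"
  shows "(\<lambda>x. step_law M (f x) (\<beta> x)) \<in> X \<rightarrow>\<^sub>M prob_algebra (step_space M)"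
  unfolding step_law_eq
  by (rule measurable_bind_prob_space2[OF measurable_compose[OF f p_c] action_law_kernel[OF f \<beta>]])

lemma p_c_space: "s \<in> space (states M) \<Longrightarrow> p_c M s \<in> space (prob_algebra (confs M))"
  using measurable_space[OF p_c] .

lemma space_p_c: "s \<in> space (states M) \<Longrightarrow> space (p_c M s) = space (confs M)"
  using p_c_space[of s] by (intro sets_eq_imp_space_eq) (simp add: space_prob_algebra)

lemma integral_reward_law:
  assumes s: "s \<in> space (states M)" and c: "c \<in> space (confs M)"
    and \<phi> [measurable]: "\<phi> \<in> borel_measurable (step_space M)"
    and B: "\<And>x. x \<in> space (step_space M) \<Longrightarrow> \<bar>\<phi> x\<bar> \<le> B"
  shows "(\<integral>x. \<phi> x \<partial>reward_law a m s c) = (\<integral>r. (\<phi> (s, c, a, m, r) :: real) \<partial>p_r M s c a m)"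
proof -
  have sc: "(s, c) \<in> space (states M \<Otimes>\<^sub>M confs M)" using s c by (simp add: space_pair_measure)
  have "p_r M s c a m \<in> space (prob_algebra borel)"
    using measurable_space[OF p_r sc, of a m] by simp
  moreover have "(\<lambda>r. return (step_space M) (s, c, a, m, r)) \<in> borel \<rightarrow>\<^sub>M prob_algebra (step_space M)"
    using measurable_compose[OF measurable_Pair1'[OF sc] return_step_kernel[of a m]] by simp
  ultimately have "(\<integral>x. \<phi> x \<partial>reward_law a m s c)
      = (\<integral>r. \<integral>x. \<phi> x \<partial>return (step_space M) (s, c, a, m, r) \<partial>p_r M s c a m)"
    unfolding reward_law_def by (rule integral_bind_prob_algebra[OF _ _ \<phi> B])
  also have "\<dots> = (\<integral>r. \<phi> (s, c, a, m, r) \<partial>p_r M s c a m)"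
  proof (intro Bochner_Integration.integral_cong refl integral_return \<phi>)
    show "(s, c, a, m, r) \<in> space (step_space M)" for r
      using s c by (simp add: step_space_def space_pair_measure)
  qed
  finally show ?thesis .
qed

lemma integral_step_law:
  assumes s: "s \<in> space (states M)"
    and \<beta>: "\<And>a. (\<lambda>c. pmf (\<beta> c) a) \<in> borel_measurable (confs M)"
    and \<phi>: "\<phi> \<in> borel_measurable (step_space M)"
    and B: "\<And>x. x \<in> space (step_space M) \<Longrightarrow> \<bar>\<phi> x\<bar> \<le> B"
  shows "(\<integral>x. \<phi> x \<partial>step_law M s \<beta>) =
    (\<integral>c. (\<Sum>a\<in>UNIV. pmf (\<beta> c) a * (\<Sum>m\<in>UNIV. pmf (p_m M s c a) m *
      (\<integral>r. (\<phi> (s, c, a, m, r) :: real) \<partial>p_r M s c a m))) \<partial>p_c M s)"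
proof -
  have space_pmf: "measure_pmf p \<in> space (prob_algebra (count_space UNIV))" for p :: "'x pmf"
    by (simp add: space_prob_algebra measure_pmf.prob_space_axioms)
  have "action_law s \<beta> \<in> confs M \<rightarrow>\<^sub>M prob_algebra (step_space M)"
  proof -
    \<comment> \<open>State and control are fixed here, so the kernel lemma is used over a one-point
      parameter space.\<close>
    have *: "(\<lambda>c. ((), c)) \<in> confs M \<rightarrow>\<^sub>M count_space UNIV \<Otimes>\<^sub>M confs M" by measurable
    show ?thesis
      using measurable_compose[OF * action_law_kernel[of "\<lambda>_. s" "count_space UNIV" "\<lambda>_. \<beta>"]] s \<beta>
      by (simp add: case_prod_beta)
  qed
  then have "(\<integral>x. \<phi> x \<partial>step_law M s \<beta>) = (\<integral>c. \<integral>x. \<phi> x \<partial>action_law s \<beta> c \<partial>p_c M s)"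
    unfolding step_law_eq by (rule integral_bind_prob_algebra[OF p_c_space[OF s] _ \<phi> B])
  also have "\<dots> = (\<integral>c. (\<Sum>a\<in>UNIV. pmf (\<beta> c) a * (\<Sum>m\<in>UNIV. pmf (p_m M s c a) m *
      (\<integral>r. (\<phi> (s, c, a, m, r) :: real) \<partial>p_r M s c a m))) \<partial>p_c M s)"
  proof (intro Bochner_Integration.integral_cong refl)
    fix c assume "c \<in> space (p_c M s)"
    then have c: "c \<in> space (confs M)"
      by (simp add: space_p_c[OF s])
    then have sc: "(s, c) \<in> space (states M \<Otimes>\<^sub>M confs M)" using s by (simp add: space_pair_measure)
    have mediator: "(\<integral>x. \<phi> x \<partial>mediator_law a s c) =
        (\<Sum>m\<in>UNIV. pmf (p_m M s c a) m * (\<integral>x. \<phi> x \<partial>reward_law a m s c))" for a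
    proof -
      have "(\<lambda>m. reward_law a m s c) \<in> count_space UNIV \<rightarrow>\<^sub>M prob_algebra (step_space M)"
        using measurable_space[OF reward_law_kernel sc] by auto
      then show ?thesis
        unfolding mediator_law_def
        by (subst integral_bind_prob_algebra[OF space_pmf _ \<phi> B]) (auto simp: integral_pmf_finite)
    qed
    have "(\<lambda>a. mediator_law a s c) \<in> count_space UNIV \<rightarrow>\<^sub>M prob_algebra (step_space M)"
      using measurable_space[OF mediator_law_kernel sc] by auto
    then have "(\<integral>x. \<phi> x \<partial>action_law s \<beta> c) = (\<Sum>a\<in>UNIV. pmf (\<beta> c) a * (\<integral>x. \<phi> x \<partial>mediator_law a s c))"
      unfolding action_law_def
      by (subst integral_bind_prob_algebra[OF space_pmf _ \<phi> B]) (auto simp: integral_pmf_finite)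
    then show "(\<integral>x. \<phi> x \<partial>action_law s \<beta> c) =
      (\<Sum>a\<in>UNIV. pmf (\<beta> c) a * (\<Sum>m\<in>UNIV. pmf (p_m M s c a) m *
        (\<integral>r. (\<phi> (s, c, a, m, r) :: real) \<partial>p_r M s c a m)))"
      by (simp only: mediator integral_reward_law[OF s c \<phi> B])
  qed
  finally show ?thesis .
qed

text \<open>Everything drawn after the state has total mass 1 and so integrates out.\<close>

lemma integral_step_law_state:
  fixes v :: "'s \<Rightarrow> real"
  assumes s: "s \<in> space (states M)"
    and \<beta>: "\<And>a. (\<lambda>c. pmf (\<beta> c) a) \<in> borel_measurable (confs M)"
    and v: "v \<in> borel_measurable (states M)" "\<And>s. s \<in> space (states M) \<Longrightarrow> \<bar>v s\<bar> \<le> B"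
  shows "(\<integral>x. v (state_of x) \<partial>step_law M s \<beta>) = v s"
proof -
  interpret p_c: prob_space "p_c M s" using p_c_space[OF s] by (simp add: space_prob_algebra)
  have "(\<integral>x. v (state_of x) \<partial>step_law M s \<beta>) = (\<integral>c. v s \<partial>p_c M s)"
  proof (subst integral_step_law[OF s \<beta>])
    show "(\<lambda>x. v (state_of x)) \<in> borel_measurable (step_space M)"
      using v(1) by measurable
    show "\<bar>v (state_of x)\<bar> \<le> B" if "x \<in> space (step_space M)" for x
      using v(2) measurable_space[OF measurable_step_components(1) that] by simp
    show "(\<integral>c. (\<Sum>a\<in>UNIV. pmf (\<beta> c) a * (\<Sum>m\<in>UNIV. pmf (p_m M s c a) m *
        (\<integral>r. v (state_of (s, c, a, m, r)) \<partial>p_r M s c a m))) \<partial>p_c M s) = (\<integral>c. v s \<partial>p_c M s)"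
    proof (intro Bochner_Integration.integral_cong refl)
      fix c assume "c \<in> space (p_c M s)"
      then have c: "c \<in> space (confs M)"
        by (simp add: space_p_c[OF s])
      then have "prob_space (p_r M s c a m)" for a m
        using measurable_space[OF p_r, of "(s, c)" a m] s by (simp add: space_pair_measure space_prob_algebra)
      then have "(\<integral>r. v (state_of (s, c, a, m, r)) \<partial>p_r M s c a m) = v s" for a m
        by (simp add: prob_space.prob_space)
      then show "(\<Sum>a\<in>UNIV. pmf (\<beta> c) a * (\<Sum>m\<in>UNIV. pmf (p_m M s c a) m *
        (\<integral>r. v (state_of (s, c, a, m, r)) \<partial>p_r M s c a m))) = v s"
        by (simp only: sum_pmf_mult_const)
    qed
  qed
  then show ?thesis by (simp add: p_c.prob_space)
qed

text \<open>\<open>p_s\<close> is jointly measurable in state and confounder for each fixed action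
  and mediator; the two discrete coordinates are inserted by gluing over their values.\<close>

lemma next_state_kernel: "next_state M \<in> step_space M \<rightarrow>\<^sub>M prob_algebra (states M)"
proof -
  have ns: "next_state M = (\<lambda>x. p_s M (fst x) (fst (snd x)) (fst (snd (snd x))) (fst (snd (snd (snd x)))))"
    by (auto simp: fun_eq_iff)
  have 1: "(\<lambda>x. p_s M (fst x) (fst (snd x)) a m) \<in> step_space M \<rightarrow>\<^sub>M prob_algebra (states M)" for a m
  proof -
    have "(\<lambda>x. (fst x, fst (snd x))) \<in> step_space M \<rightarrow>\<^sub>M states M \<Otimes>\<^sub>M confs M"
      unfolding step_space_def by measurable
    from measurable_compose[OF this p_s[of a m]] show ?thesis by simp
  qed
  have am: "(\<lambda>x. fst (snd (snd x))) \<in> step_space M \<rightarrow>\<^sub>M count_space UNIV"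
    "(\<lambda>x. fst (snd (snd (snd x)))) \<in> step_space M \<rightarrow>\<^sub>M count_space UNIV"
    unfolding step_space_def by measurable
  have 2: "(\<lambda>x. p_s M (fst x) (fst (snd x)) a (fst (snd (snd (snd x))))) \<in> step_space M \<rightarrow>\<^sub>M prob_algebra (states M)" for a
    by (rule measurable_compose_countable[OF 1 am(2)])
  show ?thesis
    unfolding ns by (rule measurable_compose_countable[OF 2 am(1)])
qed

end

section \<open>Trajectories with an arbitrary first step and an arbitrary control\<close>

lemma state_of_in_states: "x \<in> space (step_space M) \<Longrightarrow> state_of x \<in> space (states M)"
  by (rule measurable_space[OF measurable_step_components(1)])

text \<open>One setting for three laws: online trajectories, the trajectories behind
  \<open>Q\<close>, whose first step is \<open>step_given\<close>, and the offline data, whose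
  control reads the confounder.\<close>

locale m2dp_trajectory = m2dp_model M
  for M :: "('s, 'c, 'a::finite, 'm::finite) m2dp" +
  fixes \<nu> :: "('s, 'c, 'a, 'm) step measure"
    and \<alpha> :: "nat \<Rightarrow> (nat \<Rightarrow> 's \<times> 'a \<times> 'm \<times> real) \<Rightarrow> 's \<Rightarrow> 'c \<Rightarrow> 'a pmf"
  assumes start: "\<nu> \<in> space (prob_algebra (step_space M))"
    and control: "\<And>t a. (\<lambda>((h, s), c). pmf (\<alpha> t h s c) a) \<in>
      borel_measurable ((history_space M t \<Otimes>\<^sub>M states M) \<Otimes>\<^sub>M confs M)"
begin

lemma control_pointwise:
  assumes "h \<in> space (history_space M t)" "s \<in> space (states M)"
  shows "(\<lambda>c. pmf (\<alpha> t h s c) a) \<in> borel_measurable (confs M)"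
  using measurable_compose[OF measurable_Pair1'[of "(h, s)"] control[of t a]] assms
  by (simp add: space_pair_measure)

lemma controlled_step_kernel:
  "(\<lambda>(h, s). step_law M s (\<alpha> t h s)) \<in> history_space M t \<Otimes>\<^sub>M states M \<rightarrow>\<^sub>M prob_algebra (step_space M)"
  using step_law_kernel[of snd "history_space M t \<Otimes>\<^sub>M states M" "\<lambda>x. \<alpha> t (fst x) (snd x)"] control[of t]
  by (simp add: case_prod_beta')

lemma controlled_step_kernel':
  "h \<in> space (history_space M t) \<Longrightarrow> (\<lambda>s. step_law M s (\<alpha> t h s)) \<in> states M \<rightarrow>\<^sub>M prob_algebra (step_space M)"
  using measurable_compose[OF measurable_Pair1' controlled_step_kernel[of t]] by simp

lemma trajectory_kernel_0: "trajectory_kernel M \<nu> \<alpha> 0 = (\<lambda>_. \<nu>)"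
  by (simp add: trajectory_kernel_def fun_eq_iff)

lemma trajectory_kernel_Suc:
  "trajectory_kernel M \<nu> \<alpha> (Suc t) = (\<lambda>\<omega>. next_state M (\<omega> t) \<bind>
    (\<lambda>s. step_law M s (\<alpha> (Suc t) (observed_history (Suc t) \<omega>) s)))"
  by (simp add: trajectory_kernel_def fun_eq_iff)

lemma trajectory_kernel:
  "trajectory_kernel M \<nu> \<alpha> t \<in> Pi\<^sub>M {0..<t} (\<lambda>_. step_space M) \<rightarrow>\<^sub>M prob_algebra (step_space M)"
proof (cases t)
  case 0
  then show ?thesis using start by (simp add: trajectory_kernel_0)
next
  case (Suc n)
  let ?X = "Pi\<^sub>M {0..<Suc n} (\<lambda>_. step_space M)"
  have "(\<lambda>(\<omega>, s). (observed_history (Suc n) \<omega>, s)) \<in> ?X \<Otimes>\<^sub>M states M \<rightarrow>\<^sub>M history_space M (Suc n) \<Otimes>\<^sub>M states M"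
    using measurable_observed_history[of "Suc n" "{0..<Suc n}" M] by measurable
  from measurable_compose[OF this controlled_step_kernel]
  have "(\<lambda>(\<omega>, s). step_law M s (\<alpha> (Suc n) (observed_history (Suc n) \<omega>) s))
      \<in> ?X \<Otimes>\<^sub>M states M \<rightarrow>\<^sub>M prob_algebra (step_space M)"
    by (simp add: case_prod_beta')
  moreover have "(\<lambda>\<omega>. next_state M (\<omega> n)) \<in> ?X \<rightarrow>\<^sub>M prob_algebra (states M)"
    by (rule measurable_compose[OF _ next_state_kernel]) (simp add: measurable_component_singleton)
  ultimately show ?thesis
    unfolding Suc trajectory_kernel_Suc by (intro measurable_bind_prob_space2)
qed

sublocale IT: Ionescu_Tulcea "trajectory_kernel M \<nu> \<alpha>" "\<lambda>_. step_space M"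
proof (rule Ionescu_Tulcea.intro)
  show "trajectory_kernel M \<nu> \<alpha> t \<in> Pi\<^sub>M {0..<t} (\<lambda>_. step_space M) \<rightarrow>\<^sub>M subprob_algebra (step_space M)" for t
    by (rule measurable_prob_algebraD[OF trajectory_kernel])
  show "prob_space (trajectory_kernel M \<nu> \<alpha> t \<omega>)"
    if "\<omega> \<in> space (Pi\<^sub>M {0..<t} (\<lambda>_. step_space M))" for t \<omega>
    using measurable_space[OF trajectory_kernel that] by (simp add: space_prob_algebra)
qed

abbreviation law :: "(nat \<Rightarrow> ('s, 'c, 'a, 'm) step) measure" where
  "law \<equiv> trajectory_law M \<nu> \<alpha>"

sublocale law: prob_space law
  using IT.prob_space_lim by (simp add: trajectory_law_def)

lemma sets_law [measurable_cong, simp]: "sets law = sets (Pi\<^sub>M UNIV (\<lambda>_. step_space M))"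
  by (simp add: trajectory_law_def)

lemma space_law: "space law = space (Pi\<^sub>M UNIV (\<lambda>_. step_space M))"
  by (rule sets_eq_imp_space_eq) simp

lemma component_in_step_space: "\<omega> \<in> space law \<Longrightarrow> \<omega> t \<in> space (step_space M)"
  by (simp add: space_law space_PiM PiE_iff)

lemma state_in_states: "\<omega> \<in> space law \<Longrightarrow> state_of (\<omega> t) \<in> space (states M)"
  by (rule state_of_in_states[OF component_in_step_space])

lemma observed_history_in_space:
  "\<omega> \<in> space law \<Longrightarrow> observed_history t \<omega> \<in> space (history_space M t)"
  using measurable_space[OF measurable_observed_history[of t UNIV M]] by (simp add: space_law)

lemma integral_law_step:
  fixes f :: "(nat \<Rightarrow> ('s, 'c, 'a, 'm) step) \<times> ('s, 'c, 'a, 'm) step \<Rightarrow> real"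
  assumes "f \<in> borel_measurable (Pi\<^sub>M {0..<t} (\<lambda>_. step_space M) \<Otimes>\<^sub>M step_space M)"
    and "\<And>z. z \<in> space (Pi\<^sub>M {0..<t} (\<lambda>_. step_space M) \<Otimes>\<^sub>M step_space M) \<Longrightarrow> \<bar>f z\<bar> \<le> B"
  shows "(\<integral>\<omega>. f (restrict \<omega> {0..<t}, \<omega> t) \<partial>law) =
    (\<integral>\<omega>. \<integral>x. f (restrict \<omega> {0..<t}, x) \<partial>trajectory_kernel M \<nu> \<alpha> t (restrict \<omega> {0..<t}) \<partial>law)"
  unfolding trajectory_law_def by (rule IT.integral_lim_step[OF assms])

lemma integral_law_component:
  assumes \<phi>: "\<phi> \<in> borel_measurable (step_space M)" "\<And>x. x \<in> space (step_space M) \<Longrightarrow> \<bar>\<phi> x\<bar> \<le> (B :: real)"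
  shows "(\<integral>\<omega>. \<phi> (\<omega> t) \<partial>law) =
    (\<integral>\<omega>. \<integral>x. \<phi> x \<partial>trajectory_kernel M \<nu> \<alpha> t (restrict \<omega> {0..<t}) \<partial>law)"
proof -
  have "\<bar>\<phi> (snd z)\<bar> \<le> B" if "z \<in> space (Pi\<^sub>M {0..<t} (\<lambda>_. step_space M) \<Otimes>\<^sub>M step_space M)" for z
    using measurable_space[OF measurable_snd that] by (rule \<phi>(2))
  from integral_law_step[of "\<lambda>z. \<phi> (snd z)", OF _ this] \<phi>(1) show ?thesis by simp
qed

lemma integral_trajectory_kernel_Suc:
  assumes \<omega>: "\<omega> \<in> space law"
    and \<phi>: "\<phi> \<in> borel_measurable (step_space M)" "\<And>x. x \<in> space (step_space M) \<Longrightarrow> \<bar>\<phi> x\<bar> \<le> (B :: real)"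
  shows "(\<integral>x. \<phi> x \<partial>trajectory_kernel M \<nu> \<alpha> (Suc t) (restrict \<omega> {0..<Suc t})) =
    (\<integral>s. \<integral>x. \<phi> x \<partial>step_law M s (\<alpha> (Suc t) (observed_history (Suc t) \<omega>) s) \<partial>next_state M (\<omega> t))"
proof -
  have "next_state M (\<omega> t) \<in> space (prob_algebra (states M))"
    by (rule measurable_space[OF next_state_kernel component_in_step_space[OF \<omega>]])
  from integral_bind_prob_algebra[OF this controlled_step_kernel'[OF observed_history_in_space[OF \<omega>]] \<phi>]
  show ?thesis
    unfolding trajectory_kernel_Suc observed_history_restrict by simp
qed

lemma integral_law_0:
  assumes \<phi>: "\<phi> \<in> borel_measurable (step_space M)" "\<And>x. x \<in> space (step_space M) \<Longrightarrow> \<bar>\<phi> x\<bar> \<le> (B :: real)"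
  shows "(\<integral>\<omega>. \<phi> (\<omega> 0) \<partial>law) = (\<integral>x. \<phi> x \<partial>\<nu>)"
  using integral_law_component[OF \<phi>, of 0] by (simp add: trajectory_kernel_0 law.prob_space)

text \<open>Given the whole past, the next state has law \<open>next_state M (\<omega> t)\<close>,
  and the remaining variables of step \<open>Suc t\<close> integrate out. The weight
  \<open>\<phi>\<close> is 1 in the telescoping and a test function of the step at time
  \<open>t\<close> in the Bellman equation.\<close>

lemma integral_law_next_state:
  assumes [measurable]: "\<phi> \<in> borel_measurable (step_space M)" "v \<in> borel_measurable (states M)"
    and \<phi>: "\<And>x. x \<in> space (step_space M) \<Longrightarrow> \<bar>\<phi> x\<bar> \<le> (B :: real)"
    and v: "\<And>s. s \<in> space (states M) \<Longrightarrow> \<bar>v s\<bar> \<le> (B' :: real)"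
  shows "(\<integral>\<omega>. \<phi> (\<omega> t) * v (state_of (\<omega> (Suc t))) \<partial>law) =
    (\<integral>\<omega>. \<phi> (\<omega> t) * (\<integral>s. v s \<partial>next_state M (\<omega> t)) \<partial>law)"
proof -
  let ?f = "\<lambda>z :: (nat \<Rightarrow> ('s, 'c, 'a, 'm) step) \<times> ('s, 'c, 'a, 'm) step. \<phi> (fst z t) * v (state_of (snd z))"
  have "(\<lambda>z. fst z t) \<in> Pi\<^sub>M {0..<Suc t} (\<lambda>_. step_space M) \<Otimes>\<^sub>M step_space M \<rightarrow>\<^sub>M step_space M"
    by (rule measurable_compose[OF measurable_fst measurable_component_singleton]) simp
  then have [measurable]: "?f \<in> borel_measurable (Pi\<^sub>M {0..<Suc t} (\<lambda>_. step_space M) \<Otimes>\<^sub>M step_space M)"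
    by measurable
  note st = state_of_in_states[of _ M]
  have "\<bar>?f z\<bar> \<le> B * B'" if "z \<in> space (Pi\<^sub>M {0..<Suc t} (\<lambda>_. step_space M) \<Otimes>\<^sub>M step_space M)" for z
  proof -
    have "fst z t \<in> space (step_space M)" "snd z \<in> space (step_space M)"
      using that by (auto simp: space_pair_measure space_PiM PiE_iff)
    then show ?thesis
      using mult_mono[OF \<phi> v[OF st] order_trans[OF abs_ge_zero \<phi>] abs_ge_zero] by (simp add: abs_mult)
  qed
  from integral_law_step[of ?f "Suc t", OF _ this]
  have "(\<integral>\<omega>. \<phi> (\<omega> t) * v (state_of (\<omega> (Suc t))) \<partial>law) =
    (\<integral>\<omega>. \<integral>x. \<phi> (\<omega> t) * v (state_of x) \<partial>trajectory_kernel M \<nu> \<alpha> (Suc t) (restrict \<omega> {0..<Suc t}) \<partial>law)"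
    by simp
  also have "\<dots> = (\<integral>\<omega>. \<phi> (\<omega> t) * (\<integral>s. v s \<partial>next_state M (\<omega> t)) \<partial>law)"
  proof (intro Bochner_Integration.integral_cong refl)
    fix \<omega> assume \<omega>: "\<omega> \<in> space law"
    have "(\<integral>x. v (state_of x) \<partial>trajectory_kernel M \<nu> \<alpha> (Suc t) (restrict \<omega> {0..<Suc t})) =
      (\<integral>s. \<integral>x. v (state_of x) \<partial>step_law M s (\<alpha> (Suc t) (observed_history (Suc t) \<omega>) s) \<partial>next_state M (\<omega> t))"
      by (rule integral_trajectory_kernel_Suc[OF \<omega>, of _ B']) (auto intro!: v st)
    also have "\<dots> = (\<integral>s. v s \<partial>next_state M (\<omega> t))"
    proof (intro Bochner_Integration.integral_cong refl)
      fix s assume "s \<in> space (next_state M (\<omega> t))"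
      then have "s \<in> space (states M)"
        using measurable_space[OF next_state_kernel component_in_step_space[OF \<omega>]]
        by (auto simp: space_prob_algebra dest: sets_eq_imp_space_eq)
      then show "(\<integral>x. v (state_of x) \<partial>step_law M s (\<alpha> (Suc t) (observed_history (Suc t) \<omega>) s)) = v s"
        by (intro integral_step_law_state[of _ _ _ B'] control_pointwise observed_history_in_space \<omega> v) auto
    qed
    finally show "(\<integral>x. \<phi> (\<omega> t) * v (state_of x) \<partial>trajectory_kernel M \<nu> \<alpha> (Suc t) (restrict \<omega> {0..<Suc t})) =
        \<phi> (\<omega> t) * (\<integral>s. v s \<partial>next_state M (\<omega> t))"
      by simp
  qed
  finally show ?thesis .
qed

text \<open>Separates starts in which the first action is drawn by the control, as for online and
  offline laws, from those such as \<open>step_given\<close>, where it is prescribed. The function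
  \<open>\<lambda>_. undefined\<close> is the only point of the empty product, hence the only
  history at time 0.\<close>

definition from_state_law :: "'s measure \<Rightarrow> bool" where
  "from_state_law \<mu> \<longleftrightarrow> \<mu> \<in> space (prob_algebra (states M)) \<and>
    \<nu> = \<mu> \<bind> (\<lambda>s. step_law M s (\<alpha> 0 (\<lambda>_. undefined) s))"

lemma integral_start:
  assumes \<mu>: "from_state_law \<mu>"
    and \<phi>: "\<phi> \<in> borel_measurable (step_space M)" "\<And>x. x \<in> space (step_space M) \<Longrightarrow> \<bar>\<phi> x\<bar> \<le> (B :: real)"
  shows "(\<integral>x. \<phi> x \<partial>\<nu>) = (\<integral>s. \<integral>x. \<phi> x \<partial>step_law M s (\<alpha> 0 (\<lambda>_. undefined) s) \<partial>\<mu>)"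
proof -
  have "(\<lambda>_. undefined) \<in> space (history_space M 0)" by (simp add: space_PiM)
  from integral_bind_prob_algebra[OF _ controlled_step_kernel'[OF this] \<phi>, of \<mu>] \<mu>
  show ?thesis by (simp add: from_state_law_def)
qed

lemma integral_initial_state:
  assumes \<mu>: "from_state_law \<mu>"
    and v: "v \<in> borel_measurable (states M)" "\<And>s. s \<in> space (states M) \<Longrightarrow> \<bar>v s\<bar> \<le> (B :: real)"
  shows "(\<integral>\<omega>. v (state_of (\<omega> 0)) \<partial>law) = (\<integral>s. v s \<partial>\<mu>)"
proof -
  have vs: "(\<lambda>x. v (state_of x)) \<in> borel_measurable (step_space M)"
    "x \<in> space (step_space M) \<Longrightarrow> \<bar>v (state_of x)\<bar> \<le> B" for x
    using v by (auto intro: measurable_compose dest: state_of_in_states)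
  have "(\<integral>\<omega>. v (state_of (\<omega> 0)) \<partial>law) =
      (\<integral>s. \<integral>x. v (state_of x) \<partial>step_law M s (\<alpha> 0 (\<lambda>_. undefined) s) \<partial>\<mu>)"
    using integral_law_0[OF vs] integral_start[OF \<mu> vs] by simp
  also have "\<dots> = (\<integral>s. v s \<partial>\<mu>)"
  proof (intro Bochner_Integration.integral_cong refl)
    fix s assume "s \<in> space \<mu>"
    then have "s \<in> space (states M)"
      using \<mu> by (auto simp: from_state_law_def space_prob_algebra dest: sets_eq_imp_space_eq)
    then show "(\<integral>x. v (state_of x) \<partial>step_law M s (\<alpha> 0 (\<lambda>_. undefined) s)) = v s"
      by (intro integral_step_law_state[of _ _ _ B] control_pointwise v) (auto simp: space_PiM)
  qed
  finally show ?thesis .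
qed

text \<open>At time 0 this needs the action to be drawn by the control as well.\<close>

lemma integral_law_action:
  assumes t: "t = 0 \<Longrightarrow> from_state_law \<mu>"
    and \<phi>: "\<phi> \<in> borel_measurable (step_space M)" "\<And>x. x \<in> space (step_space M) \<Longrightarrow> \<bar>\<phi> x\<bar> \<le> (B :: real)"
  shows "(\<integral>\<omega>. \<phi> (\<omega> t) \<partial>law) =
    (\<integral>\<omega>. \<integral>x. \<phi> x \<partial>step_law M (state_of (\<omega> t)) (\<alpha> t (observed_history t \<omega>) (state_of (\<omega> t))) \<partial>law)"
proof -
  \<comment> \<open>The conditional mean of \<open>\<phi>\<close> over the step at time
    \<open>t\<close>, given the observed history and the current state.\<close>
  define \<Phi> where "\<Phi> h s = (\<integral>x. \<phi> x \<partial>step_law M s (\<alpha> t h s))" for h s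
  have \<Phi>_meas [measurable]: "(\<lambda>(h, s). \<Phi> h s) \<in> borel_measurable (history_space M t \<Otimes>\<^sub>M states M)"
    unfolding \<Phi>_def case_prod_beta'
    using measurable_integral_kernel[OF _ controlled_step_kernel, of "\<lambda>_. \<phi>" t] \<phi>(1)
    by (simp add: case_prod_beta')
  have \<Phi>_bound: "\<bar>\<Phi> h s\<bar> \<le> B" if "h \<in> space (history_space M t)" "s \<in> space (states M)" for h s
  proof -
    have "step_law M s (\<alpha> t h s) \<in> space (prob_algebra (step_space M))"
      using measurable_space[OF controlled_step_kernel'] that by blast
    then have "prob_space (step_law M s (\<alpha> t h s))" "space (step_law M s (\<alpha> t h s)) = space (step_space M)"
      by (auto simp: space_prob_algebra dest: sets_eq_imp_space_eq)
    then show ?thesis unfolding \<Phi>_def using \<phi>(2) by (intro abs_integral_le_bound) auto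
  qed
  show ?thesis
  proof (cases t)
    case 0
    then have \<mu>: "from_state_law \<mu>" using t by simp
    have u: "(\<lambda>_. undefined) \<in> space (history_space M t)" by (simp add: space_PiM 0)
    have "(\<integral>\<omega>. \<phi> (\<omega> t) \<partial>law) = (\<integral>s. \<Phi> (\<lambda>_. undefined) s \<partial>\<mu>)"
      using integral_law_0[OF \<phi>] integral_start[OF \<mu> \<phi>] by (simp add: \<Phi>_def 0)
    also have "\<dots> = (\<integral>\<omega>. \<Phi> (\<lambda>_. undefined) (state_of (\<omega> 0)) \<partial>law)"
      using \<Phi>_bound[OF u] measurable_compose[OF measurable_Pair1'[OF u] \<Phi>_meas]
      by (intro integral_initial_state[OF \<mu>, symmetric]) auto
    finally show ?thesis by (simp add: \<Phi>_def 0)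
  next
    case (Suc n)
    have "(\<integral>\<omega>. \<phi> (\<omega> t) \<partial>law) =
      (\<integral>\<omega>. \<integral>x. \<phi> x \<partial>trajectory_kernel M \<nu> \<alpha> t (restrict \<omega> {0..<t}) \<partial>law)"
      by (rule integral_law_component[OF \<phi>])
    \<comment> \<open>Both inner integrals equal the mean of \<open>\<Phi> ?h\<close> under the law
      of the next state: the one of \<open>\<phi>\<close> by the definition of
      \<open>\<Phi>\<close>, the other because its integrand depends on the state of the step
      only.\<close>
    also have "\<dots> = (\<integral>\<omega>. \<integral>x. \<Phi> (observed_history t \<omega>) (state_of x)
        \<partial>trajectory_kernel M \<nu> \<alpha> t (restrict \<omega> {0..<t}) \<partial>law)"
    proof (rule Bochner_Integration.integral_cong[OF refl])
      fix \<omega> assume \<omega>: "\<omega> \<in> space law"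
      let ?h = "observed_history t \<omega>"
      have h: "?h \<in> space (history_space M t)" by (rule observed_history_in_space[OF \<omega>])
      have v: "\<Phi> ?h \<in> borel_measurable (states M)"
        using measurable_compose[OF measurable_Pair1'[OF h] \<Phi>_meas] by simp
      have vs: "(\<lambda>x. \<Phi> ?h (state_of x)) \<in> borel_measurable (step_space M)"
        "x \<in> space (step_space M) \<Longrightarrow> \<bar>\<Phi> ?h (state_of x)\<bar> \<le> B" for x
        using v \<Phi>_bound[OF h] by (auto intro: measurable_compose dest: state_of_in_states)
      have "(\<integral>x. \<Phi> ?h (state_of x) \<partial>trajectory_kernel M \<nu> \<alpha> t (restrict \<omega> {0..<t})) =
          (\<integral>s. \<integral>x. \<Phi> ?h (state_of x) \<partial>step_law M s (\<alpha> t ?h s) \<partial>next_state M (\<omega> n))"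
        unfolding Suc by (rule integral_trajectory_kernel_Suc[OF \<omega> vs[unfolded Suc]])
      also have "\<dots> = (\<integral>s. \<Phi> ?h s \<partial>next_state M (\<omega> n))"
      proof (intro Bochner_Integration.integral_cong refl)
        fix s assume "s \<in> space (next_state M (\<omega> n))"
        then have "s \<in> space (states M)"
          using measurable_space[OF next_state_kernel component_in_step_space[OF \<omega>]]
          by (auto simp: space_prob_algebra dest: sets_eq_imp_space_eq)
        then show "(\<integral>x. \<Phi> ?h (state_of x) \<partial>step_law M s (\<alpha> t ?h s)) = \<Phi> ?h s"
          by (intro integral_step_law_state[of _ _ _ B] control_pointwise h v \<Phi>_bound) auto
      qed
      also have "\<dots> = (\<integral>x. \<phi> x \<partial>trajectory_kernel M \<nu> \<alpha> t (restrict \<omega> {0..<t}))"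
        unfolding Suc \<Phi>_def by (rule integral_trajectory_kernel_Suc[OF \<omega> \<phi>, symmetric])
      finally show "(\<integral>x. \<phi> x \<partial>trajectory_kernel M \<nu> \<alpha> t (restrict \<omega> {0..<t})) =
        (\<integral>x. \<Phi> ?h (state_of x) \<partial>trajectory_kernel M \<nu> \<alpha> t (restrict \<omega> {0..<t}))" ..
    qed
    \<comment> \<open>The disintegration formula read backwards, which puts the actual step at time
      \<open>t\<close> back in place of the integration variable.\<close>
    also have "\<dots> = (\<integral>\<omega>. \<Phi> (observed_history t \<omega>) (state_of (\<omega> t)) \<partial>law)"
    proof -
      let ?f = "\<lambda>z. \<Phi> (observed_history t (fst z)) (state_of (snd z))"
      have "(\<lambda>z. (observed_history t (fst z), state_of (snd z)))
          \<in> Pi\<^sub>M {0..<t} (\<lambda>_. step_space M) \<Otimes>\<^sub>M step_space M \<rightarrow>\<^sub>M history_space M t \<Otimes>\<^sub>M states M"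
        using measurable_observed_history[of t "{0..<t}" M] by measurable
      note * = measurable_space[OF this] measurable_compose[OF this \<Phi>_meas]
      have "\<bar>?f z\<bar> \<le> B" if "z \<in> space (Pi\<^sub>M {0..<t} (\<lambda>_. step_space M) \<Otimes>\<^sub>M step_space M)" for z
        using *(1)[OF that] by (intro \<Phi>_bound) (auto simp: space_pair_measure)
      from integral_law_step[of ?f t, OF _ this] *(2) show ?thesis by simp
    qed
    finally show ?thesis by (simp add: \<Phi>_def)
  qed
qed

end

section \<open>The Bellman operator\<close>

locale front_door_model = m2dp_model M
  for M :: "('s, 'c, 'a::finite, 'm::finite) m2dp" +
  fixes q :: "'s \<Rightarrow> 'a \<Rightarrow> 'm pmf" and R :: real
  assumes front_door: "front_door M q"
    and R_nonneg: "0 \<le> R"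
    and reward_bound: "\<And>s c a m. s \<in> space (states M) \<Longrightarrow> c \<in> space (confs M) \<Longrightarrow>
      AE r in p_r M s c a m. \<bar>r\<bar> \<le> R"
begin

text \<open>Rewards are bounded only almost surely; truncation makes all integrands bounded everywhere.\<close>

definition clip :: "real \<Rightarrow> real" where
  "clip r = max (- R) (min R r)"

lemma clip_measurable [measurable]: "clip \<in> borel_measurable borel"
  unfolding clip_def by measurable

lemma abs_clip: "\<bar>clip r\<bar> \<le> R"
  using R_nonneg by (auto simp: clip_def)

lemma clip_eq: "\<bar>r\<bar> \<le> R \<Longrightarrow> clip r = r"
  by (auto simp: clip_def)

text \<open>\<open>R + \<gamma> W = W\<close>, so values bounded by \<open>W\<close> are mapped to such values by the Bellman operator.\<close>

definition W :: real where "W = R / (1 - discount M)"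

lemma W_eq: "R + discount M * W = W"
  using discount by (simp add: W_def field_simps)

lemma W_nonneg: "0 \<le> W"
  using discount R_nonneg by (simp add: W_def)

text \<open>The set on which the Bellman operator acts. Fixing the radius \<open>W\<close> makes it
  invariant, and nothing is required outside the state space.\<close>

definition bounded_value :: "('s \<Rightarrow> real) \<Rightarrow> bool" where
  "bounded_value v \<longleftrightarrow> v \<in> borel_measurable (states M) \<and> (\<forall>s\<in>space (states M). \<bar>v s\<bar> \<le> W)"

lemma bounded_valueD:
  assumes "bounded_value v"
  shows "v \<in> borel_measurable (states M)" "s \<in> space (states M) \<Longrightarrow> \<bar>v s\<bar> \<le> W"
  using assms by (auto simp: bounded_value_def)

definition one_step :: "('s \<Rightarrow> real) \<Rightarrow> 's \<Rightarrow> 'c \<Rightarrow> 'a \<Rightarrow> 'm \<Rightarrow> real" where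
  "one_step v s c a m = (\<integral>r. clip r \<partial>p_r M s c a m) + discount M * (\<integral>s'. v s' \<partial>p_s M s c a m)"

lemma p_r_prob:
  assumes "s \<in> space (states M)" "c \<in> space (confs M)"
  shows "prob_space (p_r M s c a m)" "sets (p_r M s c a m) = sets borel"
  using measurable_space[OF p_r, of "(s, c)" a m] assms by (auto simp: space_pair_measure space_prob_algebra)

lemma p_s_prob:
  assumes "s \<in> space (states M)" "c \<in> space (confs M)"
  shows "prob_space (p_s M s c a m)" "sets (p_s M s c a m) = sets (states M)"
    "space (p_s M s c a m) = space (states M)"
proof -
  show "prob_space (p_s M s c a m)" "sets (p_s M s c a m) = sets (states M)"
    using measurable_space[OF p_s, of "(s, c)" a m] assms by (auto simp: space_pair_measure space_prob_algebra)
  then show "space (p_s M s c a m) = space (states M)"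
    by (intro sets_eq_imp_space_eq)
qed

lemma p_c_prob:
  assumes "s \<in> space (states M)"
  shows "prob_space (p_c M s)" "sets (p_c M s) = sets (confs M)"
  using p_c_space[OF assms] by (auto simp: space_prob_algebra)

lemma one_step_measurable:
  assumes "bounded_value v"
  shows "(\<lambda>(s, c). one_step v s c a m) \<in> borel_measurable (states M \<Otimes>\<^sub>M confs M)"
proof -
  have "(\<lambda>x. \<integral>r. clip r \<partial>(case x of (s, c) \<Rightarrow> p_r M s c a m)) \<in> borel_measurable (states M \<Otimes>\<^sub>M confs M)"
    by (rule measurable_compose[OF measurable_prob_algebraD[OF p_r] integral_measurable_subprob_algebra]) simp
  moreover have "(\<lambda>x. \<integral>s'. v s' \<partial>(case x of (s, c) \<Rightarrow> p_s M s c a m)) \<in> borel_measurable (states M \<Otimes>\<^sub>M confs M)"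
    by (rule measurable_compose[OF measurable_prob_algebraD[OF p_s] integral_measurable_subprob_algebra])
      (rule bounded_valueD[OF assms])
  ultimately show ?thesis
    unfolding one_step_def case_prod_beta' by measurable
qed

lemma one_step_measurable':
  assumes "bounded_value v" "s \<in> space (states M)"
  shows "(\<lambda>c. one_step v s c a m) \<in> borel_measurable (confs M)"
  using measurable_compose[OF measurable_Pair1'[OF assms(2)] one_step_measurable[OF assms(1)]] by simp

lemma abs_one_step:
  assumes "bounded_value v" "s \<in> space (states M)" "c \<in> space (confs M)"
  shows "\<bar>one_step v s c a m\<bar> \<le> W"
proof -
  have "\<bar>\<integral>r. clip r \<partial>p_r M s c a m\<bar> \<le> R"
    by (rule abs_integral_le_bound[OF p_r_prob(1)[OF assms(2,3)] abs_clip])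
  moreover have "\<bar>\<integral>s'. v s' \<partial>p_s M s c a m\<bar> \<le> W"
    by (rule abs_integral_le_bound[OF p_s_prob(1)[OF assms(2,3)]])
      (simp add: p_s_prob(3)[OF assms(2,3)] bounded_valueD[OF assms(1)])
  then have "\<bar>discount M * (\<integral>s'. v s' \<partial>p_s M s c a m)\<bar> \<le> discount M * W"
    using discount by (simp add: abs_mult mult_left_mono)
  ultimately show ?thesis unfolding one_step_def using W_eq by linarith
qed

lemma one_step_action:
  assumes "s \<in> space (states M)" "c \<in> space (confs M)"
  shows "one_step v s c a m = one_step v s c a' m"
proof -
  have "p_r M s c a m = p_r M s c a' m" "p_s M s c a m = p_s M s c a' m"
    using front_door assms by (auto simp: front_door_def)
  then show ?thesis by (simp add: one_step_def)
qed

lemma one_step_integrable: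
  assumes "bounded_value v" "s \<in> space (states M)"
  shows "integrable (p_c M s) (\<lambda>c. one_step v s c a m)"
proof (rule integrable_bounded[OF p_c_prob(1)[OF assms(2)], where B=W])
  show "(\<lambda>c. one_step v s c a m) \<in> borel_measurable (p_c M s)"
    using one_step_measurable'[OF assms] by (simp add: p_c_prob(2)[OF assms(2)] cong: measurable_cong_sets)
qed (simp add: space_p_c assms abs_one_step)

lemma one_step_diff:
  assumes v: "bounded_value v" and w: "bounded_value w"
    and d: "\<And>s. s \<in> space (states M) \<Longrightarrow> \<bar>v s - w s\<bar> \<le> d"
    and s: "s \<in> space (states M)" and c: "c \<in> space (confs M)"
  shows "\<bar>one_step v s c a m - one_step w s c a m\<bar> \<le> discount M * d"
proof -
  have int: "integrable (p_s M s c a m) u" if "bounded_value u" for u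
    using that bounded_valueD
    by (intro integrable_bounded[OF p_s_prob(1)[OF s c], where B=W])
      (auto simp: p_s_prob[OF s c] cong: measurable_cong_sets)
  \<comment> \<open>The reward terms cancel; only the discounted continuation differs, hence the
    factor \<open>discount M\<close>.\<close>
  have "one_step v s c a m - one_step w s c a m = discount M * (\<integral>s'. v s' - w s' \<partial>p_s M s c a m)"
    unfolding one_step_def by (simp add: int v w algebra_simps)
  moreover have "\<bar>\<integral>s'. v s' - w s' \<partial>p_s M s c a m\<bar> \<le> d"
    using d by (intro abs_integral_le_bound[OF p_s_prob(1)[OF s c]]) (simp add: p_s_prob(3)[OF s c])
  ultimately show ?thesis using discount by (simp add: abs_mult mult_left_mono)
qed

definition action_value :: "('s \<Rightarrow> real) \<Rightarrow> 's \<Rightarrow> 'a \<Rightarrow> real" where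
  "action_value v s a = (\<Sum>m\<in>UNIV. pmf (q s a) m * (\<integral>c. one_step v s c a m \<partial>p_c M s))"

text \<open>\<open>q\<close> is tied to \<open>p_m\<close> only pointwise. As \<open>p_m\<close>
  does not vary with the confounder, averaging it over the kernel \<open>p_c\<close> returns
  \<open>q\<close>, and this average is measurable in the state.\<close>

lemma mediator_measurable: "(\<lambda>s. pmf (q s a) m) \<in> borel_measurable (states M)"
proof -
  have "(\<lambda>s. \<integral>c. pmf (p_m M s c a) m \<partial>p_c M s) \<in> borel_measurable (states M)"
    by (rule measurable_integral_kernel[OF p_m p_c])
  also have "?this \<longleftrightarrow> ?thesis"
  proof (rule measurable_cong)
    fix s assume s: "s \<in> space (states M)"
    interpret prob_space "p_c M s" by (rule p_c_prob[OF s])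
    have "(\<integral>c. pmf (p_m M s c a) m \<partial>p_c M s) = (\<integral>c. pmf (q s a) m \<partial>p_c M s)"
      using front_door s by (intro Bochner_Integration.integral_cong) (auto simp: space_p_c front_door_def)
    then show "(\<integral>c. pmf (p_m M s c a) m \<partial>p_c M s) = pmf (q s a) m" by (simp add: prob_space)
  qed
  finally show ?thesis .
qed

lemma action_value_measurable:
  assumes "bounded_value v"
  shows "(\<lambda>s. action_value v s a) \<in> borel_measurable (states M)"
  unfolding action_value_def
  by (intro borel_measurable_sum borel_measurable_times mediator_measurable
      measurable_integral_kernel[OF one_step_measurable[OF assms] p_c])

lemma abs_action_value:
  assumes "bounded_value v" "s \<in> space (states M)"
  shows "\<bar>action_value v s a\<bar> \<le> W"
  unfolding action_value_def using assms
  by (intro abs_sum_pmf_le abs_integral_le_bound p_c_prob) (auto simp: space_p_c abs_one_step)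

lemma action_value_diff:
  assumes v: "bounded_value v" and w: "bounded_value w"
    and d: "\<And>s. s \<in> space (states M) \<Longrightarrow> \<bar>v s - w s\<bar> \<le> d"
    and s: "s \<in> space (states M)"
  shows "\<bar>action_value v s a - action_value w s a\<bar> \<le> discount M * d"
proof -
  have "action_value v s a - action_value w s a =
      (\<Sum>m\<in>UNIV. pmf (q s a) m * (\<integral>c. one_step v s c a m - one_step w s c a m \<partial>p_c M s))"
    unfolding action_value_def
    by (simp add: one_step_integrable v w s right_diff_distrib sum_subtractf)
  moreover have "\<bar>\<integral>c. one_step v s c a m - one_step w s c a m \<partial>p_c M s\<bar> \<le> discount M * d" for m
    using one_step_diff[OF v w d s]
    by (intro abs_integral_le_bound[OF p_c_prob(1)[OF s]]) (simp add: space_p_c[OF s])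
  ultimately show ?thesis by (simp add: abs_sum_pmf_le)
qed

section \<open>Value iteration and the optimal value\<close>

definition bellman :: "('s \<Rightarrow> real) \<Rightarrow> 's \<Rightarrow> real" where
  "bellman v s = (MAX a. action_value v s a)"

lemma bounded_value_bellman: "bounded_value v \<Longrightarrow> bounded_value (bellman v)"
proof -
  assume v: "bounded_value v"
  \<comment> \<open>Comparison with the zero function, whose maximum is 0, turns the Lipschitz bound
    into a bound on the maximum itself.\<close>
  have "\<bar>bellman v s\<bar> \<le> W" if "s \<in> space (states M)" for s
    using abs_Max_diff_le[of "action_value v s" "\<lambda>_. 0" W] abs_action_value[OF v that]
    by (simp add: bellman_def)
  moreover have "bellman v \<in> borel_measurable (states M)"
    using measurable_Max_UNIV[OF action_value_measurable[OF v]] by (simp add: bellman_def[abs_def])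
  ultimately show ?thesis by (simp add: bounded_value_def)
qed

lemma bellman_diff:
  assumes "bounded_value v" "bounded_value w"
    and "\<And>s. s \<in> space (states M) \<Longrightarrow> \<bar>v s - w s\<bar> \<le> d" and "s \<in> space (states M)"
  shows "\<bar>bellman v s - bellman w s\<bar> \<le> discount M * d"
  unfolding bellman_def by (intro abs_Max_diff_le action_value_diff assms)

definition iter_value :: "nat \<Rightarrow> 's \<Rightarrow> real" where
  "iter_value n = (bellman ^^ n) (\<lambda>_. 0)"

text \<open>The fixed point is taken as the pointwise limit of value iteration from 0, so that it
  inherits measurability and the bound \<open>W\<close> from the iterates.\<close>

definition opt_value :: "'s \<Rightarrow> real" where
  "opt_value s = lim (\<lambda>n. iter_value n s)"

lemma bounded_iter_value: "bounded_value (iter_value n)"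
proof (induction n)
  case 0
  show ?case using W_nonneg by (simp add: iter_value_def bounded_value_def)
next
  case (Suc n)
  then show ?case using bounded_value_bellman by (simp add: iter_value_def)
qed

text \<open>The contraction is applied \<open>n\<close> times to the iterates \<open>k\<close> and
  0, whose distance is at most \<open>W\<close> because the latter is the zero function.\<close>

lemma iter_value_diff:
  "s \<in> space (states M) \<Longrightarrow> \<bar>iter_value (n + k) s - iter_value n s\<bar> \<le> discount M ^ n * W"
proof (induction n arbitrary: s)
  case 0
  then show ?case using bounded_valueD(2)[OF bounded_iter_value] by (simp add: iter_value_def)
next
  case (Suc n)
  then show ?case
    using bellman_diff[OF bounded_iter_value bounded_iter_value Suc.IH Suc.prems]
    by (simp add: iter_value_def mult.assoc)
qed

lemma discount_power_W: "(\<lambda>n. discount M ^ n * W) \<longlonglongrightarrow> 0"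
  using discount by (intro tendsto_mult_left_zero LIMSEQ_power_zero) simp

lemma iter_value_tendsto:
  assumes s: "s \<in> space (states M)"
  shows "(\<lambda>n. iter_value n s) \<longlonglongrightarrow> opt_value s"
proof -
  have "Cauchy (\<lambda>n. iter_value n s)"
    unfolding Cauchy_altdef2
  proof (intro allI impI)
    fix e :: real assume "0 < e"
    with discount_power_W have "\<forall>\<^sub>F n in sequentially. discount M ^ n * W < e"
      by (rule order_tendstoD(2))
    then obtain N where "discount M ^ N * W < e"
      by (auto simp: eventually_sequentially)
    moreover have "\<bar>iter_value n s - iter_value N s\<bar> \<le> discount M ^ N * W" if "n \<ge> N" for n
      using iter_value_diff[OF s, of N "n - N"] that by simp
    ultimately show "\<exists>N. \<forall>n\<ge>N. dist (iter_value n s) (iter_value N s) < e"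
      by (force simp: dist_real_def)
  qed
  then show ?thesis
    unfolding opt_value_def by (intro convergent_LIMSEQ_iff[THEN iffD1]) (rule Cauchy_convergent)
qed

lemma bounded_opt_value: "bounded_value opt_value"
  unfolding bounded_value_def
proof safe
  show "opt_value \<in> borel_measurable (states M)"
    by (rule borel_measurable_LIMSEQ_real[OF iter_value_tendsto bounded_valueD(1)[OF bounded_iter_value]])
  show "\<bar>opt_value s\<bar> \<le> W" if s: "s \<in> space (states M)" for s
    using tendsto_rabs[OF iter_value_tendsto[OF s]]
    by (rule Lim_bounded[where M=0]) (use bounded_valueD(2)[OF bounded_iter_value s] in auto)
qed

lemma bellman_opt_value:
  assumes s: "s \<in> space (states M)"
  shows "bellman opt_value s = opt_value s"
proof -
  \<comment> \<open>The limit in \<open>k\<close> of the Cauchy estimate. It is uniform in the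
    state, as \<open>bellman_diff\<close> requires.\<close>
  have tail: "\<bar>opt_value s - iter_value n s\<bar> \<le> discount M ^ n * W" if s: "s \<in> space (states M)" for s n
  proof (rule Lim_bounded[where M=n])
    show "(\<lambda>k. \<bar>iter_value k s - iter_value n s\<bar>) \<longlonglongrightarrow> \<bar>opt_value s - iter_value n s\<bar>"
      by (intro tendsto_intros iter_value_tendsto s)
    show "\<forall>k\<ge>n. \<bar>iter_value k s - iter_value n s\<bar> \<le> discount M ^ n * W"
      using iter_value_diff[OF s, of n "k - n" for k] by (metis le_add_diff_inverse)
  qed
  have "\<bar>iter_value (Suc n) s - bellman opt_value s\<bar> \<le> discount M * (discount M ^ n * W)" for n
    using bellman_diff[OF bounded_opt_value bounded_iter_value tail s, of n]
    by (simp add: iter_value_def abs_minus_commute)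
  then have "(\<lambda>n. iter_value (Suc n) s - bellman opt_value s) \<longlonglongrightarrow> 0"
    by (intro Lim_null_comparison[OF always_eventually tendsto_mult_right_zero[OF discount_power_W, of "discount M"]]) simp
  then have "(\<lambda>n. iter_value (Suc n) s) \<longlonglongrightarrow> bellman opt_value s"
    by (rule LIM_zero_cancel)
  with LIMSEQ_Suc[OF iter_value_tendsto[OF s]] show ?thesis
    by (rule LIMSEQ_unique[symmetric])
qed

lemma action_value_le_opt_value:
  "s \<in> space (states M) \<Longrightarrow> action_value opt_value s a \<le> opt_value s"
  using bellman_opt_value by (metis bellman_def Max_ge finite finite_imageI rangeI)

end

section \<open>Returns of policies\<close>

context front_door_model
begin

text \<open>The random variable of a single step, with the reward as realized and the next state
  already averaged, whose mean given state, confounder, action and mediator is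
  \<open>one_step v\<close>. It brings expectations along a trajectory under the one-step integral
  formulas.\<close>

definition step_value :: "('s \<Rightarrow> real) \<Rightarrow> ('s, 'c, 'a, 'm) step \<Rightarrow> real" where
  "step_value v x = clip (reward_of x) + discount M * (\<integral>s. v s \<partial>next_state M x)"

lemma integral_next_state_measurable:
  "v \<in> borel_measurable (states M) \<Longrightarrow> (\<lambda>x. \<integral>s. (v s :: real) \<partial>next_state M x) \<in> borel_measurable (step_space M)"
  by (rule measurable_compose[OF measurable_prob_algebraD[OF next_state_kernel] integral_measurable_subprob_algebra])

lemma abs_integral_next_state:
  assumes v: "bounded_value v" and x: "x \<in> space (step_space M)"
  shows "\<bar>\<integral>s. v s \<partial>next_state M x\<bar> \<le> W"
proof -
  have "prob_space (next_state M x)" "space (next_state M x) = space (states M)"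
    using measurable_space[OF next_state_kernel x]
    by (auto simp: space_prob_algebra dest: sets_eq_imp_space_eq)
  then show ?thesis using bounded_valueD[OF v] by (intro abs_integral_le_bound) auto
qed

lemma step_value_measurable:
  "bounded_value v \<Longrightarrow> step_value v \<in> borel_measurable (step_space M)"
  unfolding step_value_def[abs_def]
  using integral_next_state_measurable[OF bounded_valueD(1)] by measurable

lemma abs_step_value:
  assumes "bounded_value v" "x \<in> space (step_space M)"
  shows "\<bar>step_value v x\<bar> \<le> W"
proof -
  have "\<bar>discount M * (\<integral>s. v s \<partial>next_state M x)\<bar> \<le> discount M * W"
    using discount abs_integral_next_state[OF assms] by (simp add: abs_mult mult_left_mono)
  then show ?thesis
    using abs_clip[of "reward_of x"] W_eq unfolding step_value_def by linarith
qed

lemma integral_step_value: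
  assumes s: "s \<in> space (states M)" and c: "c \<in> space (confs M)"
  shows "(\<integral>r. step_value v (s, c, a, m, r) \<partial>p_r M s c a m) = one_step v s c a m"
proof -
  interpret prob_space "p_r M s c a m" by (rule p_r_prob[OF s c])
  have "integrable (p_r M s c a m) clip"
    using abs_clip p_r_prob[OF s c]
    by (intro integrable_bounded[where B=R]) (auto cong: measurable_cong_sets)
  then show ?thesis by (simp add: step_value_def one_step_def prob_space)
qed

text \<open>The action is drawn without regard to the confounder, so its probabilities leave the
  integral over \<open>c\<close>; the mediator probabilities do so by the front-door criterion. What
  remains is the average of \<open>one_step\<close> over the unconditioned law of the
  confounder.\<close>

lemma integral_step_value_policy:
  assumes v: "bounded_value v" and s: "s \<in> space (states M)"
  shows "(\<integral>x. step_value v x \<partial>step_law M s (\<lambda>_. p)) = (\<Sum>a\<in>UNIV. pmf p a * action_value v s a)"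
proof -
  have "(\<integral>x. step_value v x \<partial>step_law M s (\<lambda>_. p)) =
    (\<integral>c. (\<Sum>a\<in>UNIV. pmf p a * (\<Sum>m\<in>UNIV. pmf (q s a) m * one_step v s c a m)) \<partial>p_c M s)"
    by (subst integral_step_law[OF s _ step_value_measurable[OF v] abs_step_value[OF v]])
      (use front_door s in \<open>auto simp: space_p_c integral_step_value front_door_def
        intro!: Bochner_Integration.integral_cong\<close>)
  then show ?thesis
    by (simp add: action_value_def one_step_integrable[OF v s])
qed

text \<open>The integral formulas speak of bounded functions, not of almost sure statements; the
  bound on the rewards is transported along trajectories as the vanishing of the integral of this
  indicator.\<close>

definition large_reward :: "('s, 'c, 'a, 'm) step \<Rightarrow> real" where
  "large_reward x = indicat_real {x. R < \<bar>reward_of x\<bar>} x"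

lemma large_reward_measurable: "large_reward \<in> borel_measurable (step_space M)"
  unfolding large_reward_def[abs_def] by measurable

lemma abs_large_reward: "\<bar>large_reward x\<bar> \<le> 1"
  by (simp add: large_reward_def indicator_def)

lemma integral_large_reward:
  assumes "s \<in> space (states M)" "c \<in> space (confs M)"
  shows "(\<integral>r. large_reward (s, c, a, m, r) \<partial>p_r M s c a m) = 0"
  using reward_bound[OF assms, of a m]
  by (intro integral_eq_zero_AE) (auto simp: large_reward_def elim!: eventually_mono)

lemma integral_large_reward_step_law:
  assumes s: "s \<in> space (states M)" and \<beta>: "\<And>a. (\<lambda>c. pmf (\<beta> c) a) \<in> borel_measurable (confs M)"
  shows "(\<integral>x. large_reward x \<partial>step_law M s \<beta>) = 0"
proof -
  have "(\<integral>x. large_reward x \<partial>step_law M s \<beta>) = (\<integral>c. 0 \<partial>p_c M s)"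
    by (subst integral_step_law[OF s \<beta> large_reward_measurable abs_large_reward],
        rule Bochner_Integration.integral_cong[OF refl])
      (use s in \<open>simp add: space_p_c integral_large_reward\<close>)
  then show ?thesis by simp
qed

end

text \<open>The kernels control the rewards from time 1 on; \<open>start_reward\<close> supplies the
  same bound for the first step, whose law \<open>\<nu>\<close> is a parameter.\<close>

locale front_door_trajectory = front_door_model M q R + m2dp_trajectory M \<nu> \<alpha>
  for M :: "('s, 'c, 'a::finite, 'm::finite) m2dp" and q R \<nu> \<alpha> +
  assumes start_reward: "(\<integral>x. large_reward x \<partial>\<nu>) = 0"
begin

lemma AE_reward_bound: "AE \<omega> in law. \<bar>reward_of (\<omega> t)\<bar> \<le> R"
proof -
  have "(\<integral>\<omega>. large_reward (\<omega> t) \<partial>law) = 0"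
  proof (cases t)
    case 0
    then show ?thesis
      using integral_law_0[OF large_reward_measurable abs_large_reward] start_reward by simp
  next
    case (Suc n)
    have "(\<integral>\<omega>. large_reward (\<omega> t) \<partial>law) =
      (\<integral>\<omega>. \<integral>x. large_reward x \<partial>step_law M (state_of (\<omega> t)) (\<alpha> t (observed_history t \<omega>) (state_of (\<omega> t))) \<partial>law)"
      by (rule integral_law_action[OF _ large_reward_measurable abs_large_reward]) (simp add: Suc)
    also have "\<dots> = (\<integral>\<omega>. 0 \<partial>law)"
      by (intro Bochner_Integration.integral_cong refl integral_large_reward_step_law
          control_pointwise state_in_states observed_history_in_space)
    finally show ?thesis by simp
  qed
  moreover have meas: "(\<lambda>\<omega>. large_reward (\<omega> t)) \<in> borel_measurable law"
    using large_reward_measurable by measurable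
  have "integrable law (\<lambda>\<omega>. large_reward (\<omega> t))"
    by (rule integrable_bounded[OF law.prob_space_axioms meas abs_large_reward])
  ultimately have "AE \<omega> in law. large_reward (\<omega> t) = 0"
    by (subst (asm) integral_nonneg_eq_0_iff_AE) (auto simp: large_reward_def)
  then show ?thesis
    by eventually_elim (auto simp: large_reward_def indicator_def split: if_splits)
qed

lemma measurable_law_component: "f \<in> borel_measurable (step_space M) \<Longrightarrow> (\<lambda>\<omega>. f (\<omega> t)) \<in> borel_measurable law"
  unfolding measurable_cong_sets[OF sets_law refl]
  by (rule measurable_compose[of "\<lambda>\<omega>. \<omega> t" _ "step_space M"]) (auto intro: measurable_component_singleton)

lemma expected_reward: "(\<integral>\<omega>. reward_of (\<omega> t) \<partial>law) = (\<integral>\<omega>. clip (reward_of (\<omega> t)) \<partial>law)"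
  by (rule integral_cong_AE)
    (use AE_reward_bound[of t] in \<open>auto simp: clip_eq intro!: measurable_law_component elim!: eventually_mono\<close>)

lemma integral_step_value_law:
  assumes v: "bounded_value v"
  shows "(\<integral>\<omega>. step_value v (\<omega> t) \<partial>law) =
    (\<integral>\<omega>. reward_of (\<omega> t) \<partial>law) + discount M * (\<integral>\<omega>. v (state_of (\<omega> (Suc t))) \<partial>law)"
proof -
  have "integrable law (\<lambda>\<omega>. clip (reward_of (\<omega> t)))"
    using abs_clip by (intro integrable_bounded[OF law.prob_space_axioms] measurable_law_component) auto
  moreover have "integrable law (\<lambda>\<omega>. \<integral>s. v s \<partial>next_state M (\<omega> t))"
    using abs_integral_next_state[OF v component_in_step_space]
      integral_next_state_measurable[OF bounded_valueD(1)[OF v]]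
    by (intro integrable_bounded[OF law.prob_space_axioms] measurable_law_component)
  moreover have "(\<integral>\<omega>. v (state_of (\<omega> (Suc t))) \<partial>law) = (\<integral>\<omega>. \<integral>s. v s \<partial>next_state M (\<omega> t) \<partial>law)"
    using integral_law_next_state[of "\<lambda>_. 1" v 1 W t] bounded_valueD[OF v] by simp
  ultimately show ?thesis by (simp add: step_value_def expected_reward)
qed

end

section \<open>Telescoping the return of an arbitrary policy\<close>

locale front_door_policy = front_door_model M q R
  for M :: "('s, 'c, 'a::finite, 'm::finite) m2dp" and q R +
  fixes \<nu> :: "('s, 'c, 'a, 'm) step measure" and \<pi> :: "('s, 'a, 'm) policy"
  assumes start_space: "\<nu> \<in> space (prob_algebra (step_space M))"
    and start_large_reward: "(\<integral>x. large_reward x \<partial>\<nu>) = 0"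
    and policy: "\<pi> \<in> policies M"
begin

lemma policy_measurable: "(\<lambda>(h, s). pmf (\<pi> t h s) a) \<in> borel_measurable (history_space M t \<Otimes>\<^sub>M states M)"
  using policy by (simp add: policies_def)

sublocale front_door_trajectory M q R \<nu> "\<lambda>t h s c. \<pi> t h s"
proof unfold_locales
  show "(\<lambda>((h, s), c). pmf (\<pi> t h s) a) \<in>
      borel_measurable ((history_space M t \<Otimes>\<^sub>M states M) \<Otimes>\<^sub>M confs M)" for t a
    using measurable_compose[OF measurable_fst policy_measurable[of t a]]
    by (simp add: case_prod_beta')
qed (fact start_space start_large_reward)+

text \<open>The negative of the advantage of the policy at time \<open>t\<close> with respect to
  \<open>opt_value\<close>. As an average of nonnegative terms it is nonnegative pointwise; the
  difference form \<open>gap_eq\<close> serves for integration.\<close>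

definition gap :: "nat \<Rightarrow> (nat \<Rightarrow> ('s, 'c, 'a, 'm) step) \<Rightarrow> real" where
  "gap t \<omega> = (\<Sum>a\<in>UNIV. pmf (\<pi> t (observed_history t \<omega>) (state_of (\<omega> t))) a *
    (opt_value (state_of (\<omega> t)) - action_value opt_value (state_of (\<omega> t)) a))"

lemma gap_eq: "gap t \<omega> = opt_value (state_of (\<omega> t)) -
    (\<Sum>a\<in>UNIV. pmf (\<pi> t (observed_history t \<omega>) (state_of (\<omega> t))) a * action_value opt_value (state_of (\<omega> t)) a)"
  by (simp add: gap_def right_diff_distrib sum_subtractf)

lemma gap_nonneg: "\<omega> \<in> space law \<Longrightarrow> 0 \<le> gap t \<omega>"
  unfolding gap_def
  by (intro sum_nonneg mult_nonneg_nonneg) (auto simp: action_value_le_opt_value state_in_states)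

lemma integrable_opt_value: "integrable law (\<lambda>\<omega>. opt_value (state_of (\<omega> t)))"
  using bounded_valueD[OF bounded_opt_value] state_in_states
  by (intro integrable_bounded[OF law.prob_space_axioms, where B=W] measurable_law_component
      measurable_compose[OF measurable_step_components(1)]) auto

lemma integrable_policy_value: "integrable law (\<lambda>\<omega>. \<Sum>a\<in>UNIV.
    pmf (\<pi> t (observed_history t \<omega>) (state_of (\<omega> t))) a * action_value opt_value (state_of (\<omega> t)) a)"
proof (rule integrable_bounded[OF law.prob_space_axioms, where B=W])
  have "(\<lambda>\<omega>. (observed_history t \<omega>, state_of (\<omega> t))) \<in> law \<rightarrow>\<^sub>M history_space M t \<Otimes>\<^sub>M states M"
    using measurable_observed_history[of t UNIV M] by measurable
  from measurable_compose[OF this policy_measurable]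
  have "(\<lambda>\<omega>. pmf (\<pi> t (observed_history t \<omega>) (state_of (\<omega> t))) a) \<in> borel_measurable law" for a
    by simp
  moreover have "(\<lambda>\<omega>. action_value opt_value (state_of (\<omega> t)) a) \<in> borel_measurable law" for a
    by (intro measurable_law_component measurable_compose[OF measurable_step_components(1)]
        action_value_measurable bounded_opt_value)
  ultimately show "(\<lambda>\<omega>. \<Sum>a\<in>UNIV. pmf (\<pi> t (observed_history t \<omega>) (state_of (\<omega> t))) a *
      action_value opt_value (state_of (\<omega> t)) a) \<in> borel_measurable law"
    by measurable
qed (intro abs_sum_pmf_le abs_action_value bounded_opt_value state_in_states)

lemma integrable_gap: "integrable law (gap t)"
  unfolding gap_eq[abs_def] by (intro Bochner_Integration.integrable_diff integrable_opt_value integrable_policy_value)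

lemma integral_gap:
  assumes "t = 0 \<Longrightarrow> from_state_law \<mu>"
  shows "(\<integral>\<omega>. gap t \<omega> \<partial>law) =
    (\<integral>\<omega>. opt_value (state_of (\<omega> t)) \<partial>law) - (\<integral>\<omega>. step_value opt_value (\<omega> t) \<partial>law)"
proof -
  have "(\<integral>\<omega>. step_value opt_value (\<omega> t) \<partial>law) = (\<integral>\<omega>. (\<Sum>a\<in>UNIV.
      pmf (\<pi> t (observed_history t \<omega>) (state_of (\<omega> t))) a * action_value opt_value (state_of (\<omega> t)) a) \<partial>law)"
    by (subst integral_law_action[OF assms step_value_measurable[OF bounded_opt_value] abs_step_value[OF bounded_opt_value]])
      (auto intro!: Bochner_Integration.integral_cong integral_step_value_policy bounded_opt_value state_in_states)
  then show ?thesis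
    unfolding gap_eq using integrable_opt_value integrable_policy_value by simp
qed

text \<open>The free parameter \<open>d\<^sub>0\<close> accounts for a first step that is not drawn from the policy.\<close>

lemma discounted_return_telescope:
  defines "d \<equiv> \<lambda>d\<^sub>0 t. if t = 0 then d\<^sub>0 else (\<integral>\<omega>. gap t \<omega> \<partial>law)"
  shows "summable (\<lambda>t. discount M ^ t * d d\<^sub>0 t)"
    and "discounted_return M law = (\<integral>x. step_value opt_value x \<partial>\<nu>) + d\<^sub>0 - (\<Sum>t. discount M ^ t * d d\<^sub>0 t)"
proof -
  \<comment> \<open>The value sequence, except that the entry at 0 is chosen to make the temporal
    difference at time 0 equal to \<open>d\<^sub>0\<close>: the mean of
    \<open>step_value opt_value\<close> under \<open>\<nu>\<close> is the expected first reward plus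
    the discounted value at time 1.\<close>
  define u where "u t = (if t = 0 then (\<integral>x. step_value opt_value x \<partial>\<nu>) + d\<^sub>0
    else (\<integral>\<omega>. opt_value (state_of (\<omega> t)) \<partial>law))" for t
  \<comment> \<open>The entry \<open>u 0\<close> contains the arbitrary number
    \<open>d\<^sub>0\<close>, so its absolute value has to enter the bound.\<close>
  define B where "B = max W (max R \<bar>u 0\<bar>)"
  have 0: "(\<integral>\<omega>. step_value opt_value (\<omega> 0) \<partial>law) = (\<integral>x. step_value opt_value x \<partial>\<nu>)"
    by (rule integral_law_0[OF step_value_measurable[OF bounded_opt_value] abs_step_value[OF bounded_opt_value]])
  have "\<bar>\<integral>\<omega>. opt_value (state_of (\<omega> t)) \<partial>law\<bar> \<le> W" for t
    using bounded_valueD[OF bounded_opt_value] state_in_states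
    by (intro abs_integral_le_bound law.prob_space_axioms) auto
  then have u: "\<bar>u t\<bar> \<le> B" for t
    by (cases "t = 0") (auto simp: u_def B_def le_max_iff_disj)
  have "\<bar>\<integral>\<omega>. reward_of (\<omega> t) \<partial>law\<bar> \<le> R" for t
    unfolding expected_reward by (intro abs_integral_le_bound law.prob_space_axioms abs_clip)
  then have r: "\<bar>\<integral>\<omega>. reward_of (\<omega> t) \<partial>law\<bar> \<le> B" for t
    by (simp add: B_def le_max_iff_disj)
  have d: "d d\<^sub>0 t = u t - ((\<integral>\<omega>. reward_of (\<omega> t) \<partial>law) + discount M * u (Suc t))" for t
    using integral_step_value_law[OF bounded_opt_value, of t] integral_gap[of t] 0
    by (auto simp: d_def u_def)
  show "summable (\<lambda>t. discount M ^ t * d d\<^sub>0 t)"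
    by (rule discounted_telescope(1)[of "discount M" "\<lambda>t. \<integral>\<omega>. reward_of (\<omega> t) \<partial>law" B u, OF discount r u d])
  show "discounted_return M law = (\<integral>x. step_value opt_value x \<partial>\<nu>) + d\<^sub>0 - (\<Sum>t. discount M ^ t * d d\<^sub>0 t)"
    unfolding discounted_return_def discounted_telescope(2)[of "discount M" "\<lambda>t. \<integral>\<omega>. reward_of (\<omega> t) \<partial>law" B u, OF discount r u d] by (simp add: u_def)
qed

lemma integral_gap_nonneg: "0 \<le> (\<integral>\<omega>. gap t \<omega> \<partial>law)"
  by (rule Bochner_Integration.integral_nonneg) (rule gap_nonneg)

text \<open>Choosing 0 for the free parameter charges no loss to the first step, which suits
  \<open>step_given\<close>; all later gaps are nonnegative.\<close>

lemma discounted_return_le: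
  "discounted_return M law \<le> (\<integral>x. step_value opt_value x \<partial>\<nu>)"
proof -
  have "0 \<le> (\<Sum>t. discount M ^ t * (if t = 0 then 0 else (\<integral>\<omega>. gap t \<omega> \<partial>law)))"
    by (rule suminf_nonneg[OF discounted_return_telescope(1)]) (simp add: discount integral_gap_nonneg)
  then show ?thesis using discounted_return_telescope(2)[of 0] by linarith
qed

lemma discounted_return_eq:
  assumes "\<And>t \<omega>. \<omega> \<in> space law \<Longrightarrow> gap t \<omega> = 0"
  shows "discounted_return M law = (\<integral>x. step_value opt_value x \<partial>\<nu>)"
proof -
  have "(\<integral>\<omega>. gap t \<omega> \<partial>law) = (\<integral>\<omega>. 0 \<partial>law)" for t
    by (intro Bochner_Integration.integral_cong refl assms)
  then have "(\<lambda>t. discount M ^ t * (if t = 0 then 0 else (\<integral>\<omega>. gap t \<omega> \<partial>law))) = (\<lambda>_. 0)"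
    by (auto simp: fun_eq_iff)
  then show ?thesis using discounted_return_telescope(2)[of 0] by (simp only: suminf_zero)
qed

text \<open>With the expected gap at time 0 as free parameter, the leading term becomes the mean of
  \<open>opt_value\<close> over the initial state, and the sum runs over all gaps.\<close>

lemma discounted_return_from_state:
  assumes \<mu>: "from_state_law \<mu>"
  shows "summable (\<lambda>t. discount M ^ t * (\<integral>\<omega>. gap t \<omega> \<partial>law))"
    and "discounted_return M law = (\<integral>s. opt_value s \<partial>\<mu>) - (\<Sum>t. discount M ^ t * (\<integral>\<omega>. gap t \<omega> \<partial>law))"
proof -
  have *: "(\<lambda>t. if t = 0 then (\<integral>\<omega>. gap 0 \<omega> \<partial>law) else (\<integral>\<omega>. gap t \<omega> \<partial>law)) = (\<lambda>t. \<integral>\<omega>. gap t \<omega> \<partial>law)"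
    by auto
  show "summable (\<lambda>t. discount M ^ t * (\<integral>\<omega>. gap t \<omega> \<partial>law))"
    using discounted_return_telescope(1)[of "\<integral>\<omega>. gap 0 \<omega> \<partial>law"] by (simp add: fun_cong[OF *])
  have "(\<integral>\<omega>. gap 0 \<omega> \<partial>law) = (\<integral>s. opt_value s \<partial>\<mu>) - (\<integral>x. step_value opt_value x \<partial>\<nu>)"
    using integral_gap[OF \<mu>] integral_initial_state[OF \<mu> bounded_valueD[OF bounded_opt_value]]
      integral_law_0[OF step_value_measurable[OF bounded_opt_value] abs_step_value[OF bounded_opt_value]]
    by simp
  then show "discounted_return M law = (\<integral>s. opt_value s \<partial>\<mu>) - (\<Sum>t. discount M ^ t * (\<integral>\<omega>. gap t \<omega> \<partial>law))"
    using discounted_return_telescope(2)[of "\<integral>\<omega>. gap 0 \<omega> \<partial>law"] by (simp add: fun_cong[OF *])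
qed

text \<open>A convergent series of nonnegative terms with sum 0 vanishes termwise, and a nonnegative
  function with integral 0 vanishes almost surely. The condition on \<open>t\<close> matters for
  discount 0, where the actions after time 0 do not affect the return.\<close>

lemma optimal_imp_gap_0:
  assumes \<mu>: "from_state_law \<mu>" and opt: "(\<integral>s. opt_value s \<partial>\<mu>) \<le> discounted_return M law"
    and t: "0 < discount M ^ t"
  shows "AE \<omega> in law. gap t \<omega> = 0"
proof -
  let ?d = "\<lambda>t. discount M ^ t * (\<integral>\<omega>. gap t \<omega> \<partial>law)"
  have nonneg: "0 \<le> ?d t" for t
    by (simp add: discount integral_gap_nonneg)
  have "(\<Sum>t. ?d t) = 0"
    using opt discounted_return_from_state(2)[OF \<mu>] suminf_nonneg[OF discounted_return_from_state(1)[OF \<mu>] nonneg]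
    by linarith
  then have "?d t = 0"
    using suminf_eq_zero_iff[OF discounted_return_from_state(1)[OF \<mu>] nonneg] by blast
  then have "(\<integral>\<omega>. gap t \<omega> \<partial>law) = 0"
    using t by (metis mult_eq_0_iff less_irrefl)
  then show ?thesis
    by (subst (asm) integral_nonneg_eq_0_iff_AE[OF integrable_gap]) (auto simp: gap_nonneg)
qed

end

lemma det_stationary_policy:
  assumes "f \<in> states M \<rightarrow>\<^sub>M count_space UNIV"
  shows "det_stationary f \<in> policies M"
proof -
  have "(\<lambda>(h, s). pmf (return_pmf (f s)) a) \<in> borel_measurable (history_space M t \<Otimes>\<^sub>M states M)" for t a
    unfolding case_prod_beta'
    by (rule measurable_compose[OF measurable_compose[OF measurable_snd assms]]) simp
  then show ?thesis by (simp add: policies_def det_stationary_def)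
qed

lemma started_in_simps [simp]:
  shows "states (started_in M s) = states M"
    and "init (started_in M s) = return (states M) s"
    and "step_law (started_in M s) = step_law M"
    and "discounted_return (started_in M s) = discounted_return M"
    and "policies (started_in M s) = policies M"
  by (simp_all add: fun_eq_iff started_in_def step_law_def step_space_def discounted_return_def policies_def)

text \<open>Changing the initial distribution alters none of the kernels, so a return in
  \<open>started_in M s\<close> is a return in \<open>M\<close> with another start.\<close>

lemma trajectory_law_started_in [simp]: "trajectory_law (started_in M s) = trajectory_law M"
proof -
  have "next_state (started_in M s) = next_state M"
    by (auto simp: fun_eq_iff started_in_def)
  then have "trajectory_kernel (started_in M s) = trajectory_kernel M"
    by (intro ext) (simp only: trajectory_kernel_def started_in_simps)
  moreover have "step_space (started_in M s) = step_space M"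
    by (simp add: step_space_def started_in_def)
  ultimately show ?thesis by (intro ext) (simp only: trajectory_law_def)
qed

section \<open>Online returns and optimality from a given initial distribution\<close>

context front_door_model
begin

lemma bounded_opt_valueD:
  shows "opt_value \<in> borel_measurable (states M)" "s \<in> space (states M) \<Longrightarrow> \<bar>opt_value s\<bar> \<le> W"
  using bounded_valueD[OF bounded_opt_value] by auto

text \<open>The initial law is a parameter so that \<open>init M\<close> and the point masses behind
  \<open>started_in\<close> are treated together.\<close>

definition start_law :: "'s measure \<Rightarrow> ('s, 'a, 'm) policy \<Rightarrow> ('s, 'c, 'a, 'm) step measure" where
  "start_law \<mu> \<pi> = \<mu> \<bind> (\<lambda>s. step_law M s (\<lambda>c. \<pi> 0 (\<lambda>_. undefined) s))"

lemma front_door_policy_start_law: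
  assumes \<mu>: "\<mu> \<in> space (prob_algebra (states M))" and \<pi>: "\<pi> \<in> policies M"
  shows "front_door_policy M q R (start_law \<mu> \<pi>) \<pi>"
proof -
  let ?u = "\<lambda>_. undefined"
  have u: "?u \<in> space (history_space M 0)" by (simp add: space_PiM)
  have "(\<lambda>(h, s). pmf (\<pi> 0 h s) a) \<in> borel_measurable (history_space M 0 \<Otimes>\<^sub>M states M)" for a
    using \<pi> by (simp only: policies_def mem_Collect_eq)
  from measurable_compose[OF measurable_Pair1'[OF u] this]
  have \<pi>0: "(\<lambda>s. pmf (\<pi> 0 ?u s) a) \<in> borel_measurable (states M)" for a by simp
  have K: "(\<lambda>s. step_law M s (\<lambda>c. \<pi> 0 ?u s)) \<in> states M \<rightarrow>\<^sub>M prob_algebra (step_space M)"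
    using measurable_compose[OF measurable_fst \<pi>0] by (intro step_law_kernel) (auto simp: case_prod_beta')
  show ?thesis
  proof (unfold_locales, goal_cases)
    case 1
    show ?case
      unfolding start_law_def
      using prob_space_bind'[OF \<mu> K] sets_bind'[OF \<mu> K] by (simp add: space_prob_algebra)
  next
    case 2
    have "(\<integral>x. large_reward x \<partial>start_law \<mu> \<pi>) =
        (\<integral>s. \<integral>x. large_reward x \<partial>step_law M s (\<lambda>c. \<pi> 0 ?u s) \<partial>\<mu>)"
      unfolding start_law_def
      by (rule integral_bind_prob_algebra[OF \<mu> K large_reward_measurable abs_large_reward])
    also have "\<dots> = (\<integral>s. 0 \<partial>\<mu>)"
    proof (rule Bochner_Integration.integral_cong[OF refl])
      fix s assume "s \<in> space \<mu>"
      then have "s \<in> space (states M)"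
        using \<mu> by (auto simp: space_prob_algebra dest: sets_eq_imp_space_eq)
      then show "(\<integral>x. large_reward x \<partial>step_law M s (\<lambda>c. \<pi> 0 ?u s)) = 0"
        by (rule integral_large_reward_step_law) simp
    qed
    finally show ?case by simp
  qed (fact \<pi>)
qed

definition online_law :: "'s measure \<Rightarrow> ('s, 'a, 'm) policy \<Rightarrow> (nat \<Rightarrow> ('s, 'c, 'a, 'm) step) measure" where
  "online_law \<mu> \<pi> = trajectory_law M (start_law \<mu> \<pi>) (\<lambda>t h s c. \<pi> t h s)"

lemma online_eq: "online M \<pi> = online_law (init M) \<pi>"
  by (simp add: online_def online_law_def start_law_def)

lemma J_eq: "J M \<pi> = discounted_return M (online_law (init M) \<pi>)"
  by (simp add: J_def online_eq)

lemma J_started_in_eq: "J (started_in M s) \<pi> = discounted_return M (online_law (return (states M) s) \<pi>)"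
  by (simp add: J_def online_def online_law_def start_law_def)

lemma state_in_states_online:
  assumes "\<mu> \<in> space (prob_algebra (states M))" and "\<pi> \<in> policies M" and "\<omega> \<in> space (online_law \<mu> \<pi>)"
  shows "state_of (\<omega> t) \<in> space (states M)"
proof -
  interpret front_door_policy M q R "start_law \<mu> \<pi>" \<pi>
    by (rule front_door_policy_start_law) fact+
  show ?thesis using state_in_states assms by (simp add: online_law_def)
qed

lemma online_return_le:
  assumes "\<mu> \<in> space (prob_algebra (states M))" and "\<pi> \<in> policies M"
  shows "discounted_return M (online_law \<mu> \<pi>) \<le> (\<integral>s. opt_value s \<partial>\<mu>)"
proof -
  interpret front_door_policy M q R "start_law \<mu> \<pi>" \<pi>
    by (rule front_door_policy_start_law) fact+
  have \<mu>: "from_state_law \<mu>"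
    unfolding from_state_law_def using assms by (simp add: start_law_def)
  have "0 \<le> (\<Sum>t. discount M ^ t * (\<integral>\<omega>. gap t \<omega> \<partial>law))"
    by (rule suminf_nonneg[OF discounted_return_from_state(1)[OF \<mu>]]) (simp add: discount integral_gap_nonneg)
  then show ?thesis
    using discounted_return_from_state(2)[OF \<mu>] by (simp add: online_law_def)
qed

lemma online_return_greedy:
  assumes "\<mu> \<in> space (prob_algebra (states M))" and f: "f \<in> states M \<rightarrow>\<^sub>M count_space UNIV"
    and greedy: "\<And>s. s \<in> space (states M) \<Longrightarrow> action_value opt_value s (f s) = opt_value s"
  shows "discounted_return M (online_law \<mu> (det_stationary f)) = (\<integral>s. opt_value s \<partial>\<mu>)"
proof -
  interpret front_door_policy M q R "start_law \<mu> (det_stationary f)" "det_stationary f"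
    by (rule front_door_policy_start_law[OF _ det_stationary_policy]) fact+
  have \<mu>: "from_state_law \<mu>"
    unfolding from_state_law_def using assms by (simp add: start_law_def)
  have "gap t \<omega> = 0" if "\<omega> \<in> space law" for t \<omega>
    using greedy[OF state_in_states[OF that, of t]]
    unfolding gap_def by (simp add: det_stationary_def sum_pmf_return)
  then have "(\<integral>\<omega>. gap t \<omega> \<partial>law) = (\<integral>\<omega>. 0 \<partial>law)" for t
    by (intro Bochner_Integration.integral_cong refl)
  then show ?thesis
    using discounted_return_from_state(2)[OF \<mu>] by (simp add: online_law_def)
qed

lemma online_return_optimal_imp:
  assumes "\<mu> \<in> space (prob_algebra (states M))" and f: "f \<in> states M \<rightarrow>\<^sub>M count_space UNIV"
    and opt: "(\<integral>s. opt_value s \<partial>\<mu>) \<le> discounted_return M (online_law \<mu> (det_stationary f))"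
    and t: "0 < discount M ^ t"
  shows "AE \<omega> in online_law \<mu> (det_stationary f).
    action_value opt_value (state_of (\<omega> t)) (f (state_of (\<omega> t))) = opt_value (state_of (\<omega> t))"
proof -
  interpret front_door_policy M q R "start_law \<mu> (det_stationary f)" "det_stationary f"
    by (rule front_door_policy_start_law[OF _ det_stationary_policy]) fact+
  have \<mu>: "from_state_law \<mu>"
    unfolding from_state_law_def using assms by (simp add: start_law_def)
  have "AE \<omega> in law. gap t \<omega> = 0"
    by (rule optimal_imp_gap_0[OF \<mu> _ t]) (use opt in \<open>simp add: online_law_def\<close>)
  then show ?thesis
    unfolding online_law_def gap_def by eventually_elim (simp add: det_stationary_def sum_pmf_return)
qed

text \<open>The initial law is a point mass at \<open>s\<close>. Since singletons need not be
  measurable, the argument goes through the mean of the indicator of \<open>P\<close>, which is 1 by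
  the almost sure hypothesis and equals the value of the indicator at \<open>s\<close>.\<close>

lemma state_0_online:
  assumes s: "s \<in> space (states M)" and \<pi>: "\<pi> \<in> policies M"
    and P [measurable]: "Measurable.pred (states M) P"
    and AE: "AE \<omega> in online_law (return (states M) s) \<pi>. P (state_of (\<omega> 0))"
  shows "P s"
proof -
  have ret: "return (states M) s \<in> space (prob_algebra (states M))"
    using measurable_space[OF measurable_return_prob_space s] .
  interpret front_door_policy M q R "start_law (return (states M) s) \<pi>" \<pi>
    by (rule front_door_policy_start_law) fact+
  have \<mu>: "from_state_law (return (states M) s)"
    unfolding from_state_law_def using ret by (simp add: start_law_def)
  let ?v = "\<lambda>s. indicat_real {s. P s} s"
  have v: "?v \<in> borel_measurable (states M)" by measurable
  have "(\<integral>\<omega>. ?v (state_of (\<omega> 0)) \<partial>law) = (\<integral>s. ?v s \<partial>return (states M) s)"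
    by (rule integral_initial_state[OF \<mu> v, where B=1]) (simp add: indicator_def)
  also have "\<dots> = ?v s" by (rule integral_return[OF s v])
  finally have "(\<integral>\<omega>. ?v (state_of (\<omega> 0)) \<partial>law) = ?v s" .
  moreover have "(\<integral>\<omega>. ?v (state_of (\<omega> 0)) \<partial>law) = (\<integral>\<omega>. 1 \<partial>law)"
  proof (rule integral_cong_AE)
    show "(\<lambda>\<omega>. ?v (state_of (\<omega> 0))) \<in> borel_measurable law"
      by (rule measurable_law_component[OF measurable_compose[OF measurable_step_components(1) v]])
    show "AE \<omega> in law. ?v (state_of (\<omega> 0)) = 1"
      using AE unfolding online_law_def by eventually_elim simp
  qed simp
  ultimately show ?thesis by (simp add: law.prob_space indicator_def split: if_splits)
qed

text \<open>Ties are broken by the least code \<open>to_nat\<close>. This makes the selection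
  measurable: the states at which a given action is selected are described by finitely many
  comparisons of measurable functions.\<close>

definition greedy_action :: "'s \<Rightarrow> 'a" where
  "greedy_action s = arg_min to_nat (\<lambda>a. action_value opt_value s a = opt_value s)"

lemma opt_value_attained:
  assumes "s \<in> space (states M)"
  shows "\<exists>a. action_value opt_value s a = opt_value s"
proof -
  have "(MAX a. action_value opt_value s a) \<in> range (action_value opt_value s)"
    by (rule Max_in) auto
  then obtain a where "(MAX a. action_value opt_value s a) = action_value opt_value s a"
    by (rule rangeE)
  then show ?thesis using bellman_opt_value[OF assms] by (auto simp: bellman_def)
qed

lemma greedy_action:
  assumes "s \<in> space (states M)"
  shows "action_value opt_value s (greedy_action s) = opt_value s"
    and "action_value opt_value s b = opt_value s \<Longrightarrow> to_nat (greedy_action s) \<le> to_nat b"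
proof -
  let ?P = "\<lambda>a. action_value opt_value s a = opt_value s"
  obtain a where "?P a" using opt_value_attained[OF assms] by blast
  from arg_min_nat_lemma[of ?P, OF this, of to_nat]
  have *: "?P (arg_min to_nat ?P) \<and> (\<forall>b. ?P b \<longrightarrow> to_nat (arg_min to_nat ?P) \<le> to_nat b)" .
  show "?P (greedy_action s)" using * unfolding greedy_action_def by (rule conjunct1)
  show "?P b \<Longrightarrow> to_nat (greedy_action s) \<le> to_nat b"
    using * unfolding greedy_action_def by (elim conjE allE impE)
qed

lemma greedy_action_measurable: "greedy_action \<in> states M \<rightarrow>\<^sub>M count_space UNIV"
proof -
  note [measurable] = bounded_opt_valueD(1) action_value_measurable[OF bounded_opt_value]
  have "greedy_action -` {a} \<inter> space (states M) \<in> sets (states M)" for a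
  proof -
    have "greedy_action -` {a} \<inter> space (states M) = {s \<in> space (states M).
        action_value opt_value s a = opt_value s \<and>
        (\<forall>b. action_value opt_value s b = opt_value s \<longrightarrow> to_nat a \<le> to_nat b)}"
    proof (intro set_eqI iffI)
      fix s assume "s \<in> {s \<in> space (states M). action_value opt_value s a = opt_value s \<and>
        (\<forall>b. action_value opt_value s b = opt_value s \<longrightarrow> to_nat a \<le> to_nat b)}"
      then have s: "s \<in> space (states M)" and "to_nat a \<le> to_nat (greedy_action s)"
          "to_nat (greedy_action s) \<le> to_nat a"
        using greedy_action by auto
      then have "greedy_action s = a" by (metis antisym to_nat_split)
      then show "s \<in> greedy_action -` {a} \<inter> space (states M)" using s by simp
    qed (use greedy_action in auto)
    also have "\<dots> \<in> sets (states M)" by measurable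
    finally show ?thesis .
  qed
  then show ?thesis by (simp add: measurable_count_space_eq2_countable)
qed

lemma return_in_prob_algebra: "s \<in> space (states M) \<Longrightarrow> return (states M) s \<in> space (prob_algebra (states M))"
  by (rule measurable_space[OF measurable_return_prob_space])

text \<open>The upper bound in \<open>online_return_le\<close> is attained by
  \<open>greedy_action\<close>, so being maximal means reaching it.\<close>

lemma optimal_iff:
  "optimal M f \<longleftrightarrow> f \<in> states M \<rightarrow>\<^sub>M count_space UNIV \<and>
    (\<integral>s. opt_value s \<partial>init M) \<le> discounted_return M (online_law (init M) (det_stationary f))"
proof -
  have "J M (det_stationary greedy_action) = (\<integral>s. opt_value s \<partial>init M)"
    unfolding J_eq by (rule online_return_greedy[OF init greedy_action_measurable greedy_action(1)])
  then have "(\<forall>\<pi>\<in>policies M. J M \<pi> \<le> x) \<longleftrightarrow> (\<integral>s. opt_value s \<partial>init M) \<le> x" for x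
    using det_stationary_policy[OF greedy_action_measurable] online_return_le[OF init]
    unfolding J_eq by (intro iffI ballI) (auto dest: bspec intro: order_trans)
  then show ?thesis unfolding optimal_def J_eq by simp
qed

lemma optimal_started_in_iff:
  assumes s: "s \<in> space (states M)"
  shows "optimal (started_in M s) f \<longleftrightarrow> f \<in> states M \<rightarrow>\<^sub>M count_space UNIV \<and>
    opt_value s \<le> discounted_return M (online_law (return (states M) s) (det_stationary f))"
proof -
  have ret: "(\<integral>s. opt_value s \<partial>return (states M) s) = opt_value s"
    by (rule integral_return[OF s bounded_opt_valueD(1)])
  have "J (started_in M s) (det_stationary greedy_action) = opt_value s"
    unfolding J_started_in_eq
    using online_return_greedy[OF return_in_prob_algebra[OF s] greedy_action_measurable greedy_action(1)]
    by (simp add: ret)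
  then have "(\<forall>\<pi>\<in>policies M. J (started_in M s) \<pi> \<le> x) \<longleftrightarrow> opt_value s \<le> x" for x
    using det_stationary_policy[OF greedy_action_measurable]
      online_return_le[OF return_in_prob_algebra[OF s], unfolded ret]
    unfolding J_started_in_eq by (intro iffI ballI) (auto dest: bspec intro: order_trans)
  then show ?thesis unfolding optimal_def J_started_in_eq started_in_simps by simp
qed

text \<open>Necessity uses the gap at time 0 alone, which counts even for discount 0. With a point
  mass at \<open>s\<close> as initial law, the almost sure equality becomes an equality at
  \<open>s\<close>, and \<open>s\<close> is arbitrary.\<close>

lemma optimal_everywhere_iff:
  "(\<forall>s\<in>space (states M). optimal (started_in M s) f) \<longleftrightarrow> f \<in> states M \<rightarrow>\<^sub>M count_space UNIV \<and>
    (\<forall>s\<in>space (states M). action_value opt_value s (f s) = opt_value s)"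
proof (intro iffI conjI ballI)
  assume opt: "\<forall>s\<in>space (states M). optimal (started_in M s) f"
  \<comment> \<open>Measurability of \<open>f\<close> is extracted from optimality at some state, so
    one has to exist; the initial distribution provides it.\<close>
  have "space (states M) \<noteq> {}"
    using init prob_space.not_empty by (auto simp: space_prob_algebra dest: sets_eq_imp_space_eq)
  then show f: "f \<in> states M \<rightarrow>\<^sub>M count_space UNIV"
    using opt optimal_started_in_iff by blast
  fix s assume s: "s \<in> space (states M)"
  let ?P = "\<lambda>s. action_value opt_value s (f s) = opt_value s"
  note [measurable] = bounded_opt_valueD(1)
  have [measurable]: "(\<lambda>s. action_value opt_value s (f s)) \<in> borel_measurable (states M)"
    by (rule measurable_compose_countable[OF action_value_measurable[OF bounded_opt_value] f])
  have P: "Measurable.pred (states M) ?P" by measurable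
  have ret: "(\<integral>s. opt_value s \<partial>return (states M) s) = opt_value s"
    by (rule integral_return[OF s bounded_opt_valueD(1)])
  have "AE \<omega> in online_law (return (states M) s) (det_stationary f). ?P (state_of (\<omega> 0))"
    by (rule online_return_optimal_imp[OF return_in_prob_algebra[OF s] f])
      (use opt s optimal_started_in_iff ret in auto)
  then show "?P s"
    by (rule state_0_online[OF s det_stationary_policy[OF f] P])
next
  fix s assume *: "f \<in> states M \<rightarrow>\<^sub>M count_space UNIV \<and>
    (\<forall>s\<in>space (states M). action_value opt_value s (f s) = opt_value s)" and s: "s \<in> space (states M)"
  then show "optimal (started_in M s) f"
    using online_return_greedy[OF return_in_prob_algebra[OF s], of f]
    by (simp add: optimal_started_in_iff integral_return[OF s bounded_opt_valueD(1)])
qed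

end

section \<open>The mediated optimal Q-function\<close>

context front_door_model
begin

lemma conf_measurable:
  assumes s: "s \<in> space (states M)"
  shows "f \<in> borel_measurable (confs M) \<Longrightarrow> f \<in> borel_measurable (p_c M s)"
  using p_c_prob(2)[OF s] by (simp cong: measurable_cong_sets)

lemma behaviour_measurable:
  "s \<in> space (states M) \<Longrightarrow> (\<lambda>c. pmf (p_a M s c) a) \<in> borel_measurable (confs M)"
  using measurable_compose[OF measurable_Pair1' p_a[of a]] by simp

lemma mediator_conf_measurable:
  "s \<in> space (states M) \<Longrightarrow> (\<lambda>c. pmf (p_m M s c a) m) \<in> borel_measurable (confs M)"
  using measurable_compose[OF measurable_Pair1' p_m[of a m]] by simp

lemma p_b_nonneg: "0 \<le> p_b M s a"
  by (simp add: p_b_def)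

text \<open>Given the state and the action, the mediator is independent of the confounder, so its
  probability factors out of the joint one.\<close>

lemma p_am_eq:
  assumes s: "s \<in> space (states M)"
  shows "p_am M s a m = p_b M s a * pmf (q s a) m"
proof -
  have "p_am M s a m = (\<integral>c. pmf (p_a M s c) a * pmf (q s a) m \<partial>p_c M s)"
    unfolding p_am_def using front_door s
    by (intro Bochner_Integration.integral_cong) (auto simp: space_p_c front_door_def)
  then show ?thesis by (simp add: p_b_def)
qed

lemma conf_given_cases:
  assumes s: "s \<in> space (states M)"
  shows conf_given_prob: "prob_space (conf_given M s a m)"
    and sets_conf_given: "sets (conf_given M s a m) = sets (confs M)"
    and integral_conf_given: "f \<in> borel_measurable (confs M) \<Longrightarrow> (\<integral>c. (f c :: real) \<partial>conf_given M s a m) =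
      (if p_am M s a m > 0 then (\<integral>c. pmf (p_a M s c) a * pmf (p_m M s c a) m * f c \<partial>p_c M s) / p_am M s a m
       else if p_b M s a > 0 then (\<integral>c. pmf (p_a M s c) a * f c \<partial>p_c M s) / p_b M s a
       else (\<integral>c. f c \<partial>p_c M s))"
proof -
  note [measurable] = conf_measurable[OF s behaviour_measurable[OF s]] conf_measurable[OF s mediator_conf_measurable[OF s]]
  have meas1: "(\<lambda>c. pmf (p_a M s c) a * pmf (p_m M s c a) m) \<in> borel_measurable (p_c M s)"
    by measurable
  have meas2: "(\<lambda>c. pmf (p_a M s c) a) \<in> borel_measurable (p_c M s)"
    by measurable
  have le: "pmf (p_a M s c) a * pmf (p_m M s c a) m \<le> 1" for c
    by (intro mult_le_one pmf_nonneg pmf_le_1)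
  note 1 = prob_space_normalized_density[OF p_c_prob(1)[OF s] meas1 _ le p_am_def[of M s a m]]
  note 2 = prob_space_normalized_density[OF p_c_prob(1)[OF s] meas2 _ pmf_le_1 p_b_def[of M s a]]
  show "prob_space (conf_given M s a m)"
    using 1(1) 2(1) p_c_prob(1)[OF s] by (simp add: conf_given_def)
  show "sets (conf_given M s a m) = sets (confs M)"
    using p_c_prob(2)[OF s] by (simp add: conf_given_def)
  assume "f \<in> borel_measurable (confs M)"
  then have "f \<in> borel_measurable (p_c M s)" by (rule conf_measurable[OF s])
  then show "(\<integral>c. (f c :: real) \<partial>conf_given M s a m) =
      (if p_am M s a m > 0 then (\<integral>c. pmf (p_a M s c) a * pmf (p_m M s c a) m * f c \<partial>p_c M s) / p_am M s a m
       else if p_b M s a > 0 then (\<integral>c. pmf (p_a M s c) a * f c \<partial>p_c M s) / p_b M s a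
       else (\<integral>c. f c \<partial>p_c M s))"
    using 1(2) 2(2) by (simp add: conf_given_def)
qed

lemma space_conf_given: "s \<in> space (states M) \<Longrightarrow> space (conf_given M s a m) = space (confs M)"
  by (rule sets_eq_imp_space_eq[OF sets_conf_given])

lemma reward_law_kernel':
  "s \<in> space (states M) \<Longrightarrow> reward_law a m s \<in> confs M \<rightarrow>\<^sub>M prob_algebra (step_space M)"
  using measurable_compose[OF measurable_Pair1' reward_law_kernel[of a m]] by simp

lemma conf_given_in_prob_algebra:
  "s \<in> space (states M) \<Longrightarrow> conf_given M s a m \<in> space (prob_algebra (confs M))"
  by (simp add: space_prob_algebra conf_given_prob sets_conf_given)

lemma integral_step_given:
  assumes s: "s \<in> space (states M)" and \<phi>: "\<phi> \<in> borel_measurable (step_space M)"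
    and B: "\<And>x. x \<in> space (step_space M) \<Longrightarrow> \<bar>\<phi> x\<bar> \<le> (B :: real)"
  shows "(\<integral>x. \<phi> x \<partial>step_given M s a m) = (\<integral>c. \<integral>r. \<phi> (s, c, a, m, r) \<partial>p_r M s c a m \<partial>conf_given M s a m)"
proof -
  have "(\<integral>x. \<phi> x \<partial>step_given M s a m) = (\<integral>c. \<integral>x. \<phi> x \<partial>reward_law a m s c \<partial>conf_given M s a m)"
    unfolding step_given_eq
    by (rule integral_bind_prob_algebra[OF conf_given_in_prob_algebra[OF s] reward_law_kernel'[OF s] \<phi> B])
  also have "\<dots> = (\<integral>c. \<integral>r. \<phi> (s, c, a, m, r) \<partial>p_r M s c a m \<partial>conf_given M s a m)"
    by (rule Bochner_Integration.integral_cong[OF refl])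
      (rule integral_reward_law[OF s _ \<phi> B], simp_all add: space_conf_given s)
  finally show ?thesis .
qed

lemma front_door_policy_step_given:
  assumes s: "s \<in> space (states M)" and \<pi>: "\<pi> \<in> policies M"
  shows "front_door_policy M q R (step_given M s a m) \<pi>"
proof (unfold_locales, goal_cases)
  case 1
  show ?case
    unfolding step_given_eq
    using prob_space_bind'[OF conf_given_in_prob_algebra[OF s] reward_law_kernel'[OF s]]
      sets_bind'[OF conf_given_in_prob_algebra[OF s] reward_law_kernel'[OF s]]
    by (simp add: space_prob_algebra)
next
  case 2
  have "(\<integral>x. large_reward x \<partial>step_given M s a m) = (\<integral>c. 0 \<partial>conf_given M s a m)"
    unfolding integral_step_given[OF s large_reward_measurable abs_large_reward]
    by (rule Bochner_Integration.integral_cong[OF refl])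
      (rule integral_large_reward[OF s], simp add: space_conf_given s)
  then show ?case by simp
qed (fact \<pi>)

text \<open>The first step has the same law \<open>step_given\<close> for all policies, so the mean
  of \<open>step_value opt_value\<close> under it bounds every return; later gaps only lower the
  return. The policy \<open>greedy_action\<close> has none, so the supremum is a maximum, attained
  by one policy for all \<open>(s, a, m)\<close>.\<close>

lemma Q_opt_eq:
  assumes s: "s \<in> space (states M)"
  shows "Q_opt M s a m = (\<integral>c. one_step opt_value s c a m \<partial>conf_given M s a m)"
proof -
  have val: "(\<integral>x. step_value opt_value x \<partial>step_given M s a m) = (\<integral>c. one_step opt_value s c a m \<partial>conf_given M s a m)"
    by (rule trans[OF integral_step_given[OF s step_value_measurable[OF bounded_opt_value]
          abs_step_value[OF bounded_opt_value]] Bochner_Integration.integral_cong[OF refl]])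
      (simp_all add: integral_step_value s space_conf_given)
  have le: "Q M \<pi> s a m \<le> (\<integral>c. one_step opt_value s c a m \<partial>conf_given M s a m)" if \<pi>: "\<pi> \<in> policies M" for \<pi>
  proof -
    interpret front_door_policy M q R "step_given M s a m" \<pi>
      by (rule front_door_policy_step_given[OF s \<pi>])
    show ?thesis using discounted_return_le by (simp add: Q_def val)
  qed
  note greedy = det_stationary_policy[OF greedy_action_measurable]
  have eq: "Q M (det_stationary greedy_action) s a m = (\<integral>c. one_step opt_value s c a m \<partial>conf_given M s a m)"
  proof -
    interpret front_door_policy M q R "step_given M s a m" "det_stationary greedy_action"
      by (rule front_door_policy_step_given[OF s greedy])
    have "gap t \<omega> = 0" if "\<omega> \<in> space law" for t \<omega>
      using greedy_action(1)[OF state_in_states[OF that, of t]]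
      unfolding gap_def by (simp add: det_stationary_def sum_pmf_return)
    from discounted_return_eq[OF this] show ?thesis by (simp add: Q_def val)
  qed
  show ?thesis
    unfolding Q_opt_def
  proof (rule cSup_eq_maximum)
    show "(\<integral>c. one_step opt_value s c a m \<partial>conf_given M s a m) \<in> (\<lambda>\<pi>. Q M \<pi> s a m) ` policies M"
      unfolding eq[symmetric] by (rule imageI[OF greedy])
  qed (auto intro: le)
qed

lemma abs_Q_opt:
  "s \<in> space (states M) \<Longrightarrow> \<bar>Q_opt M s a m\<bar> \<le> W"
  unfolding Q_opt_eq
  by (intro abs_integral_le_bound conf_given_prob) (simp_all add: space_conf_given abs_one_step bounded_opt_value)

lemma behaviour_one_step_integrable:
  assumes s: "s \<in> space (states M)"
  shows "integrable (p_c M s) (\<lambda>c. pmf (p_a M s c) b * one_step opt_value s c a m)"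
proof (rule integrable_bounded[OF p_c_prob(1)[OF s], where B=W])
  show "(\<lambda>c. pmf (p_a M s c) b * one_step opt_value s c a m) \<in> borel_measurable (p_c M s)"
    by (intro conf_measurable[OF s] borel_measurable_times behaviour_measurable one_step_measurable'
        bounded_opt_value s)
  fix c assume "c \<in> space (p_c M s)"
  then have "\<bar>one_step opt_value s c a m\<bar> \<le> W"
    by (simp add: space_p_c s abs_one_step bounded_opt_value)
  then show "\<bar>pmf (p_a M s c) b * one_step opt_value s c a m\<bar> \<le> W"
    using mult_mono[OF pmf_le_1, of "\<bar>one_step opt_value s c a m\<bar>" W "p_a M s c" b]
    by (simp add: abs_mult)
qed

text \<open>Averaging the mediated optimal Q-function over the behaviour policy removes the
  conditioning on the action, because the reward and transition kernels do not depend on it.\<close>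

lemma p_b_Q_opt:
  assumes s: "s \<in> space (states M)"
  shows "p_b M s b * Q_opt M s b m = (\<integral>c. pmf (p_a M s c) b * one_step opt_value s c a m \<partial>p_c M s)"
proof -
  let ?g = "\<lambda>c. one_step opt_value s c a m"
  interpret p_c: prob_space "p_c M s" by (rule p_c_prob[OF s])
  \<comment> \<open>The action inside \<open>one_step\<close> is moved from \<open>b\<close> to an
    arbitrary \<open>a\<close>, the same for all \<open>b\<close>, so that the later sum over
    \<open>b\<close> has a common integrand.\<close>
  have "Q_opt M s b m = (\<integral>c. ?g c \<partial>conf_given M s b m)"
    unfolding Q_opt_eq[OF s]
    by (intro Bochner_Integration.integral_cong refl one_step_action s) (simp add: space_conf_given s)
  also have "\<dots> = (if p_am M s b m > 0 then (\<integral>c. pmf (p_a M s c) b * pmf (p_m M s c b) m * ?g c \<partial>p_c M s) / p_am M s b m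
       else if p_b M s b > 0 then (\<integral>c. pmf (p_a M s c) b * ?g c \<partial>p_c M s) / p_b M s b
       else (\<integral>c. ?g c \<partial>p_c M s))"
    by (rule integral_conf_given[OF s one_step_measurable'[OF bounded_opt_value s]])
  also have "(\<integral>c. pmf (p_a M s c) b * pmf (p_m M s c b) m * ?g c \<partial>p_c M s) =
      (\<integral>c. pmf (q s b) m * (pmf (p_a M s c) b * ?g c) \<partial>p_c M s)"
    using front_door s
    by (intro Bochner_Integration.integral_cong) (auto simp: space_p_c front_door_def)
  also have "\<dots> = pmf (q s b) m * (\<integral>c. pmf (p_a M s c) b * ?g c \<partial>p_c M s)"
    by simp
  finally have Q: "Q_opt M s b m = (if p_am M s b m > 0 then pmf (q s b) m * (\<integral>c. pmf (p_a M s c) b * ?g c \<partial>p_c M s) / p_am M s b m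
       else if p_b M s b > 0 then (\<integral>c. pmf (p_a M s c) b * ?g c \<partial>p_c M s) / p_b M s b
       else (\<integral>c. ?g c \<partial>p_c M s))" .
  show ?thesis
  proof (cases "p_b M s b > 0")
    \<comment> \<open>If \<open>(b, m)\<close> has positive probability, the factor
      \<open>pmf (q s b) m\<close> cancels against \<open>p_am\<close>. If not, it is the mediator
      that is impossible, and conditioning on the action alone gives the same quotient.\<close>
    case True
    then show ?thesis
      by (cases "p_am M s b m > 0") (auto simp: Q p_am_eq[OF s])
  next
    case False
    \<comment> \<open>An action of probability 0 given \<open>s\<close> has probability 0 for almost
      every confounder, so both sides vanish whatever version \<open>conf_given\<close>
      chooses.\<close>
    then have 0: "p_b M s b = 0" using p_b_nonneg[of s b] by simp
    have "integrable (p_c M s) (\<lambda>c. pmf (p_a M s c) b)"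
      by (rule integrable_bounded[OF p_c.prob_space_axioms conf_measurable[OF s behaviour_measurable[OF s]], where B=1])
        (simp add: pmf_le_1)
    then have "AE c in p_c M s. pmf (p_a M s c) b = 0"
      using 0 unfolding p_b_def by (subst (asm) integral_nonneg_eq_0_iff_AE) auto
    then have "(\<integral>c. pmf (p_a M s c) b * ?g c \<partial>p_c M s) = 0"
      by (intro integral_eq_zero_AE) (auto elim!: eventually_mono)
    then show ?thesis by (simp add: 0)
  qed
qed

lemma weighted_Q_eq:
  assumes s: "s \<in> space (states M)"
  shows "weighted_Q M q s a = action_value opt_value s a"
proof -
  \<comment> \<open>For each confounder the behaviour probabilities sum to 1 against an integrand
    free of \<open>b\<close>, so averaging over \<open>b\<close> restores the unconditioned law
    \<open>p_c\<close>.\<close>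
  have sum_b: "(\<Sum>b\<in>UNIV. p_b M s b * Q_opt M s b m) = (\<integral>c. one_step opt_value s c a m \<partial>p_c M s)" for m
  proof -
    have "(\<Sum>b\<in>UNIV. p_b M s b * Q_opt M s b m) =
        (\<integral>c. (\<Sum>b\<in>UNIV. pmf (p_a M s c) b * one_step opt_value s c a m) \<partial>p_c M s)"
      using behaviour_one_step_integrable[OF s] by (simp add: p_b_Q_opt[OF s, of _ m a] del: sum_pmf_mult_const)
    then show ?thesis by simp
  qed
  have "weighted_Q M q s a =
      (\<Sum>m\<in>UNIV. pmf (q s a) m * (\<Sum>b\<in>UNIV. p_b M s b * Q_opt M s b m))"
    unfolding weighted_Q_def by (subst sum.swap) (simp add: sum_distrib_left mult.assoc)
  also have "\<dots> = action_value opt_value s a"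
    by (simp add: sum_b action_value_def)
  finally show ?thesis .
qed

lemma Max_weighted_Q: "s \<in> space (states M) \<Longrightarrow> (MAX a. weighted_Q M q s a) = opt_value s"
  using bellman_opt_value[of s] by (simp add: weighted_Q_eq bellman_def)

lemma greedy_iff:
  assumes "s \<in> space (states M)"
  shows "greedy M q s a \<longleftrightarrow> action_value opt_value s a = opt_value s"
proof -
  obtain b where "action_value opt_value s b = opt_value s"
    using opt_value_attained[OF assms] by blast
  then show ?thesis
    using action_value_le_opt_value[OF assms]
    by (auto simp: is_arg_max_def weighted_Q_eq[OF assms] not_less intro: antisym)
      (metis antisym)
qed

text \<open>Bayes' rule with the denominator cleared: pairs of probability 0 are included, so the
  Bellman equation needs no distinction of cases.\<close>

lemma p_am_Q_opt:
  assumes s: "s \<in> space (states M)"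
  shows "p_am M s a m * Q_opt M s a m =
    (\<integral>c. pmf (p_a M s c) a * pmf (p_m M s c a) m * one_step opt_value s c a m \<partial>p_c M s)"
proof -
  have "(\<integral>c. pmf (p_a M s c) a * pmf (p_m M s c a) m * one_step opt_value s c a m \<partial>p_c M s) =
      (\<integral>c. pmf (q s a) m * (pmf (p_a M s c) a * one_step opt_value s c a m) \<partial>p_c M s)"
    using front_door s
    by (intro Bochner_Integration.integral_cong) (auto simp: space_p_c front_door_def)
  then show ?thesis
    by (simp add: p_am_eq[OF s] p_b_Q_opt[OF s, of a m a, symmetric])
qed

text \<open>A supremum over uncountably many policies need not be measurable; the closed form as an
  integral against \<open>conf_given\<close> is, case by case.\<close>

lemma Q_opt_measurable: "(\<lambda>s. Q_opt M s a m) \<in> borel_measurable (states M)"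
proof -
  let ?g = "\<lambda>s c. one_step opt_value s c a m"
  have [measurable]: "(\<lambda>(s, c). ?g s c) \<in> borel_measurable (states M \<Otimes>\<^sub>M confs M)"
    by (rule one_step_measurable[OF bounded_opt_value])
  have "(\<lambda>s. \<integral>c. pmf (p_a M s c) a * pmf (p_m M s c a) m * ?g s c \<partial>p_c M s) \<in> borel_measurable (states M)"
    "(\<lambda>s. \<integral>c. pmf (p_a M s c) a * ?g s c \<partial>p_c M s) \<in> borel_measurable (states M)"
    "(\<lambda>s. \<integral>c. ?g s c \<partial>p_c M s) \<in> borel_measurable (states M)"
    by (rule measurable_integral_kernel[OF _ p_c]; measurable)+
  moreover have "p_b M = (\<lambda>s a. \<integral>c. pmf (p_a M s c) a \<partial>p_c M s)"
    by (simp add: p_b_def fun_eq_iff)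
  then have "(\<lambda>s. p_b M s a) \<in> borel_measurable (states M)"
    using measurable_integral_kernel[OF p_a p_c] by simp
  moreover have "(\<lambda>s. p_am M s a m) \<in> borel_measurable (states M)"
    unfolding p_am_def by (rule measurable_integral_kernel[OF _ p_c]) measurable
  ultimately have "(\<lambda>s. if p_am M s a m > 0
      then (\<integral>c. pmf (p_a M s c) a * pmf (p_m M s c a) m * ?g s c \<partial>p_c M s) / p_am M s a m
      else if p_b M s a > 0 then (\<integral>c. pmf (p_a M s c) a * ?g s c \<partial>p_c M s) / p_b M s a
      else (\<integral>c. ?g s c \<partial>p_c M s)) \<in> borel_measurable (states M)"
    by measurable
  also have "?this \<longleftrightarrow> ?thesis"
  proof (rule measurable_cong)
    fix s assume s: "s \<in> space (states M)"
    show "(if p_am M s a m > 0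
      then (\<integral>c. pmf (p_a M s c) a * pmf (p_m M s c a) m * ?g s c \<partial>p_c M s) / p_am M s a m
      else if p_b M s a > 0 then (\<integral>c. pmf (p_a M s c) a * ?g s c \<partial>p_c M s) / p_b M s a
      else (\<integral>c. ?g s c \<partial>p_c M s)) = Q_opt M s a m"
      unfolding Q_opt_eq[OF s]
      by (rule integral_conf_given[OF s one_step_measurable'[OF bounded_opt_value s], symmetric])
  qed
  finally show ?thesis .
qed


section \<open>The Bellman equation under the offline law\<close>

lemma front_door_trajectory_offline:
  "front_door_trajectory M q R (init M \<bind> (\<lambda>s. step_law M s (p_a M s))) (\<lambda>t h s c. p_a M s c)"
proof -
  have K: "(\<lambda>s. step_law M s (p_a M s)) \<in> states M \<rightarrow>\<^sub>M prob_algebra (step_space M)"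
    by (rule step_law_kernel[OF measurable_ident p_a, simplified])
  show ?thesis
  proof (unfold_locales, goal_cases)
    case 1
    show ?case
      using prob_space_bind'[OF init K] sets_bind'[OF init K] by (simp add: space_prob_algebra)
  next
    case (2 t a)
    have "(\<lambda>x. (snd (fst x), snd x)) \<in> (history_space M t \<Otimes>\<^sub>M states M) \<Otimes>\<^sub>M confs M \<rightarrow>\<^sub>M states M \<Otimes>\<^sub>M confs M"
      by measurable
    from measurable_compose[OF this p_a[of a]] show ?case by (simp add: case_prod_beta')
  next
    case 3
    have "(\<integral>x. large_reward x \<partial>(init M \<bind> (\<lambda>s. step_law M s (p_a M s)))) =
        (\<integral>s. \<integral>x. large_reward x \<partial>step_law M s (p_a M s) \<partial>init M)"
      by (rule integral_bind_prob_algebra[OF init K large_reward_measurable abs_large_reward])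
    also have "\<dots> = (\<integral>s. 0 \<partial>init M)"
    proof (rule Bochner_Integration.integral_cong[OF refl])
      fix s assume "s \<in> space (init M)"
      then have "s \<in> space (states M)"
        using init by (auto simp: space_prob_algebra dest: sets_eq_imp_space_eq)
      then show "(\<integral>x. large_reward x \<partial>step_law M s (p_a M s)) = 0"
        by (intro integral_large_reward_step_law behaviour_measurable)
    qed
    finally show ?case by simp
  qed
qed

definition Q_opt_step :: "('s, 'c, 'a, 'm) step \<Rightarrow> real" where
  "Q_opt_step x = Q_opt M (state_of x) (action_of x) (mediator_of x)"

lemma abs_Q_opt_step: "x \<in> space (step_space M) \<Longrightarrow> \<bar>Q_opt_step x\<bar> \<le> W"
  by (simp add: Q_opt_step_def abs_Q_opt state_of_in_states)

lemma Q_opt_measurable_product: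
  "(\<lambda>(s, a, m). Q_opt M s a m) \<in> borel_measurable (states M \<Otimes>\<^sub>M count_space UNIV \<Otimes>\<^sub>M count_space UNIV)"
proof -
  let ?N = "states M \<Otimes>\<^sub>M count_space UNIV \<Otimes>\<^sub>M count_space (UNIV :: 'm set)"
  have "(\<lambda>x. Q_opt M (fst x) a (snd (snd x))) \<in> borel_measurable ?N" for a
    by (rule measurable_compose_countable[where g="\<lambda>x. snd (snd x)"])
      (auto intro: measurable_compose[OF measurable_fst Q_opt_measurable])
  then have "(\<lambda>x. Q_opt M (fst x) (fst (snd x)) (snd (snd x))) \<in> borel_measurable ?N"
    by (rule measurable_compose_countable[where g="\<lambda>x. fst (snd x)"]) measurable
  then show ?thesis by (simp add: case_prod_beta')
qed

text \<open>Both integrals weight the value at \<open>(a, m)\<close> by \<open>p_am\<close>, which cancels the normalization of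
  the conditional law of the confounder.\<close>

lemma integral_step_law_behaviour:
  fixes H :: "'s \<times> 'a \<times> 'm \<Rightarrow> real"
  defines "h \<equiv> \<lambda>x. H (state_of x, action_of x, mediator_of x)"
  assumes s: "s \<in> space (states M)"
    and H [measurable]: "H \<in> borel_measurable (states M \<Otimes>\<^sub>M count_space UNIV \<Otimes>\<^sub>M count_space UNIV)"
    and H_bound: "\<And>z. \<bar>H z\<bar> \<le> 1"
  shows "(\<integral>x. h x * step_value opt_value x \<partial>step_law M s (p_a M s)) =
    (\<integral>x. h x * Q_opt_step x \<partial>step_law M s (p_a M s))"
proof -
  have h [measurable]: "h \<in> borel_measurable (step_space M)"
    unfolding h_def by measurable
  have Q_opt_step [measurable]: "Q_opt_step \<in> borel_measurable (step_space M)"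
  proof -
    have "(\<lambda>x. (state_of x, action_of x, mediator_of x)) \<in> step_space M \<rightarrow>\<^sub>M
        states M \<Otimes>\<^sub>M count_space UNIV \<Otimes>\<^sub>M count_space UNIV"
      by measurable
    from measurable_compose[OF this Q_opt_measurable_product] show ?thesis
      by (simp add: Q_opt_step_def[abs_def])
  qed
  note [measurable] = step_value_measurable[OF bounded_opt_value]
  have bound: "\<bar>h x * y\<bar> \<le> W" if "\<bar>y\<bar> \<le> W" for x y
    using mult_mono[OF H_bound that] by (simp add: h_def abs_mult)
  have prob: "prob_space (p_r M s c a m)" if "c \<in> space (p_c M s)" for c a m
    using that s by (simp add: space_p_c p_r_prob)
  let ?w = "\<lambda>c a m. pmf (p_a M s c) a * pmf (p_m M s c a) m"
  have w: "integrable (p_c M s) (\<lambda>c. ?w c a m)" for a m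
  proof (rule integrable_bounded[OF p_c_prob(1)[OF s], where B=1])
    show "(\<lambda>c. ?w c a m) \<in> borel_measurable (p_c M s)"
      by (intro conf_measurable[OF s] borel_measurable_times behaviour_measurable mediator_conf_measurable s)
    show "\<bar>?w c a m\<bar> \<le> 1" for c
      using mult_le_one[OF pmf_le_1 pmf_nonneg pmf_le_1, of "p_a M s c" a "p_m M s c a" m]
      by (simp add: abs_mult)
  qed
  have w_step: "integrable (p_c M s) (\<lambda>c. ?w c a m * one_step opt_value s c a m)" for a m
  proof (rule integrable_bounded[OF p_c_prob(1)[OF s], where B=W])
    show "(\<lambda>c. ?w c a m * one_step opt_value s c a m) \<in> borel_measurable (p_c M s)"
      by (intro conf_measurable[OF s] borel_measurable_times behaviour_measurable mediator_conf_measurable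
          one_step_measurable' bounded_opt_value s)
    fix c assume "c \<in> space (p_c M s)"
    then have "\<bar>one_step opt_value s c a m\<bar> \<le> W"
      by (simp add: space_p_c s abs_one_step bounded_opt_value)
    moreover have "\<bar>?w c a m\<bar> \<le> 1"
      using mult_le_one[OF pmf_le_1 pmf_nonneg pmf_le_1, of "p_a M s c" a "p_m M s c a" m]
      by (simp add: abs_mult)
    ultimately show "\<bar>?w c a m * one_step opt_value s c a m\<bar> \<le> W"
      unfolding abs_mult[of "?w c a m"] using mult_mono[of "\<bar>?w c a m\<bar>" 1] by fastforce
  qed
  have "(\<integral>x. h x * step_value opt_value x \<partial>step_law M s (p_a M s)) =
      (\<integral>c. (\<Sum>a\<in>UNIV. pmf (p_a M s c) a * (\<Sum>m\<in>UNIV. pmf (p_m M s c a) m *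
        (\<integral>r. H (s, a, m) * step_value opt_value (s, c, a, m, r) \<partial>p_r M s c a m))) \<partial>p_c M s)"
    using integral_step_law[OF s behaviour_measurable[OF s], of "\<lambda>x. h x * step_value opt_value x" W]
      bound[OF abs_step_value[OF bounded_opt_value]]
    by (simp add: h_def)
  also have "\<dots> = (\<integral>c. (\<Sum>a\<in>UNIV. \<Sum>m\<in>UNIV. H (s, a, m) * (?w c a m * one_step opt_value s c a m)) \<partial>p_c M s)"
    by (rule Bochner_Integration.integral_cong[OF refl])
      (simp add: integral_step_value[OF s] space_p_c[OF s] sum_distrib_left mult_ac)
  \<comment> \<open>The common value of both sides. From here the expansion is undone with
    \<open>Q_opt_step\<close>, which is constant in \<open>c\<close> and \<open>r\<close>, in place
    of \<open>step_value\<close>.\<close>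
  also have "\<dots> = (\<Sum>a\<in>UNIV. \<Sum>m\<in>UNIV. H (s, a, m) * (p_am M s a m * Q_opt M s a m))"
    by (simp add: w_step p_am_Q_opt[OF s])
  also have "\<dots> = (\<integral>c. (\<Sum>a\<in>UNIV. \<Sum>m\<in>UNIV. H (s, a, m) * (?w c a m * Q_opt M s a m)) \<partial>p_c M s)"
    by (simp add: w p_am_def)
  also have "\<dots> = (\<integral>c. (\<Sum>a\<in>UNIV. pmf (p_a M s c) a * (\<Sum>m\<in>UNIV. pmf (p_m M s c a) m *
        (\<integral>r. H (s, a, m) * Q_opt_step (s, c, a, m, r) \<partial>p_r M s c a m))) \<partial>p_c M s)"
    by (rule Bochner_Integration.integral_cong[OF refl])
      (simp add: Q_opt_step_def prob_space.prob_space[OF prob] sum_distrib_left mult_ac)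
  also have "\<dots> = (\<integral>x. h x * Q_opt_step x \<partial>step_law M s (p_a M s))"
    using integral_step_law[OF s behaviour_measurable[OF s], of "\<lambda>x. h x * Q_opt_step x" W]
      bound[OF abs_Q_opt_step]
    by (simp add: h_def)
  finally show ?thesis .
qed

text \<open>A conditional expectation is characterized by its integrals over the sets of
  \<open>sigma_SAM\<close>, that is, against indicators of events in \<open>(S_t, A_t, M_t)\<close>.
  Disintegrating the step at time \<open>t\<close> reduces these integrals to
  \<open>integral_step_law_behaviour\<close>.\<close>

lemma bellman_equation:
  "AE \<omega> in offline M.
    Q_opt M (state_of (\<omega> t)) (action_of (\<omega> t)) (mediator_of (\<omega> t)) =
    real_cond_exp (offline M) (sigma_SAM M t)
      (\<lambda>\<omega>. reward_of (\<omega> t) + discount M * (MAX a. weighted_Q M q (state_of (\<omega> (Suc t))) a)) \<omega>"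
proof -
  let ?\<nu> = "init M \<bind> (\<lambda>s. step_law M s (p_a M s))"
  let ?N = "states M \<Otimes>\<^sub>M count_space UNIV \<Otimes>\<^sub>M count_space UNIV :: ('s \<times> 'a \<times> 'm) measure"
  interpret front_door_trajectory M q R ?\<nu> "\<lambda>t h s c. p_a M s c"
    by (rule front_door_trajectory_offline)
  have offline: "offline M = law" by (simp add: offline_def)
  have start: "from_state_law (init M)"
    unfolding from_state_law_def using init by simp
  let ?X = "\<lambda>\<omega> :: nat \<Rightarrow> ('s, 'c, 'a, 'm) step. (state_of (\<omega> t), action_of (\<omega> t), mediator_of (\<omega> t))"
  let ?F = "sigma_SAM M t"
  let ?f = "\<lambda>\<omega>. reward_of (\<omega> t) + discount M * (MAX a. weighted_Q M q (state_of (\<omega> (Suc t))) a)"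
  \<comment> \<open>The variant with truncated reward and with \<open>opt_value\<close> in place of
    the maximum; it agrees with \<open>?f\<close> almost surely.\<close>
  let ?f' = "\<lambda>\<omega>. clip (reward_of (\<omega> t)) + discount M * opt_value (state_of (\<omega> (Suc t)))"
  let ?g = "\<lambda>\<omega>. Q_opt_step (\<omega> t)"
  have SAM: "(\<lambda>x. (state_of x, action_of x, mediator_of x)) \<in> step_space M \<rightarrow>\<^sub>M ?N"
    by measurable
  have comp: "(\<lambda>\<omega>. \<omega> t) \<in> law \<rightarrow>\<^sub>M step_space M"
    unfolding measurable_cong_sets[OF sets_law refl] by (rule measurable_component_singleton) simp
  have X: "?X \<in> law \<rightarrow>\<^sub>M ?N"
    using measurable_compose[OF comp SAM] .
  have F: "?F = vimage_algebra (space law) ?X ?N"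
    by (simp add: sigma_SAM_def offline)
  have sub: "subalgebra law ?F"
    unfolding subalgebra_def F using sets_image_in_sets[OF _ X] by simp
  interpret F: finite_measure_subalgebra law ?F
    by unfold_locales (rule sub)
  have g_F: "?g \<in> borel_measurable ?F"
  proof -
    have "?X \<in> ?F \<rightarrow>\<^sub>M ?N"
      unfolding F by (rule measurable_vimage_algebra1) (use measurable_space[OF X] in auto)
    from measurable_compose[OF this Q_opt_measurable_product] show ?thesis
      by (simp add: Q_opt_step_def)
  qed
  have g_law: "?g \<in> borel_measurable law"
    by (rule measurable_from_subalg[OF sub g_F])
  have g_int: "integrable law ?g"
    by (rule integrable_bounded[OF law.prob_space_axioms g_law, where B=W])
      (simp add: abs_Q_opt_step component_in_step_space)
  have opt_meas: "(\<lambda>\<omega>. opt_value (state_of (\<omega> k))) \<in> borel_measurable law" for k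
    by (rule measurable_law_component[OF measurable_compose[OF measurable_step_components(1) bounded_opt_valueD(1)]])
  have rew_meas: "(\<lambda>\<omega>. reward_of (\<omega> t)) \<in> borel_measurable law"
    by (rule measurable_law_component[OF measurable_step_components(4)])
  have clip_meas: "(\<lambda>\<omega>. clip (reward_of (\<omega> t))) \<in> borel_measurable law"
    by (rule measurable_compose[OF rew_meas clip_measurable])
  have max_eq: "(MAX a. weighted_Q M q (state_of (\<omega> (Suc t))) a) = opt_value (state_of (\<omega> (Suc t)))"
    if "\<omega> \<in> space law" for \<omega>
    by (rule Max_weighted_Q[OF state_in_states[OF that]])
  have "(\<lambda>\<omega>. reward_of (\<omega> t) + discount M * opt_value (state_of (\<omega> (Suc t)))) \<in> borel_measurable law"
    by (intro borel_measurable_add borel_measurable_times rew_meas opt_meas borel_measurable_const)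
  then have f_meas: "?f \<in> borel_measurable law"
    by (subst measurable_cong) (simp_all add: max_eq)
  have f'_meas: "?f' \<in> borel_measurable law"
    by (intro borel_measurable_add borel_measurable_times clip_meas opt_meas borel_measurable_const)
  have f_f': "AE \<omega> in law. ?f \<omega> = ?f' \<omega>"
    using AE_reward_bound[of t] AE_space by eventually_elim (simp add: max_eq clip_eq)
  have clip_int: "integrable law (\<lambda>\<omega>. clip (reward_of (\<omega> t)))"
    by (rule integrable_bounded[OF law.prob_space_axioms clip_meas abs_clip])
  have opt_int: "integrable law (\<lambda>\<omega>. opt_value (state_of (\<omega> (Suc t))))"
    by (rule integrable_bounded[OF law.prob_space_axioms opt_meas, where B=W])
      (simp add: bounded_opt_valueD state_in_states)
  have f_int: "integrable law ?f"
    using integrable_cong_AE[OF f_meas f'_meas f_f'] clip_int opt_int by simp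
  have "AE \<omega> in law. real_cond_exp law ?F ?f \<omega> = ?g \<omega>"
  proof (rule F.real_cond_exp_charact[OF _ f_int g_int g_F])
    \<comment> \<open>Sets of the generated sigma-algebra are preimages under \<open>?X\<close>, so
      the indicator of \<open>A\<close> is a function \<open>h\<close> of the step at time
      \<open>t\<close> alone.\<close>
    fix A assume A: "A \<in> sets ?F"
    then obtain B where B [measurable]: "B \<in> sets ?N" and A_eq: "A = ?X -` B \<inter> space law"
      unfolding F by (subst (asm) sets_vimage_algebra2) (use measurable_space[OF X] in auto)
    define H where "H = indicat_real B"
    have H [measurable]: "H \<in> borel_measurable ?N" unfolding H_def by measurable
    have H_bound: "\<bar>H z\<bar> \<le> 1" for z by (simp add: H_def indicator_def)
    define h where "h x = H (state_of x, action_of x, mediator_of x)" for x :: "('s, 'c, 'a, 'm) step"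
    have h [measurable]: "h \<in> borel_measurable (step_space M)"
      unfolding h_def by measurable
    have h_bound: "\<bar>h x\<bar> \<le> 1" for x by (simp add: h_def H_bound)
    have bound: "\<bar>h x * y\<bar> \<le> W" if "\<bar>y\<bar> \<le> W" for x y
      using mult_mono[OF h_bound that] by (simp add: abs_mult)
    have ind: "indicator A \<omega> = h (\<omega> t)" if "\<omega> \<in> space law" for \<omega>
      using that by (simp add: h_def H_def A_eq indicator_def)
    have h_law: "(\<lambda>\<omega>. h (\<omega> t)) \<in> borel_measurable law"
      by (rule measurable_law_component[OF h])
    have h_int: "integrable law (\<lambda>\<omega>. h (\<omega> t) * u \<omega>)"
      if "integrable law u" for u
      by (rule Bochner_Integration.integrable_bound[OF that])
        (use that h_law in \<open>auto simp: abs_mult mult_left_le_one_le h_bound simp del: split_paired_All\<close>)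
    note next_meas = integral_next_state_measurable[OF bounded_opt_valueD(1)]
    have next_int: "integrable law (\<lambda>\<omega>. \<integral>s. opt_value s \<partial>next_state M (\<omega> t))"
      by (rule integrable_bounded[OF law.prob_space_axioms measurable_law_component[OF next_meas], where B=W])
        (rule abs_integral_next_state[OF bounded_opt_value component_in_step_space])
    have "(\<integral>\<omega>\<in>A. ?f \<omega> \<partial>law) = (\<integral>\<omega>. h (\<omega> t) * ?f \<omega> \<partial>law)"
      unfolding set_lebesgue_integral_def by (intro Bochner_Integration.integral_cong) (simp_all add: ind)
    also have "\<dots> = (\<integral>\<omega>. h (\<omega> t) * ?f' \<omega> \<partial>law)"
      using f_f' by (intro integral_cong_AE borel_measurable_times h_law f_meas f'_meas) auto
    also have "\<dots> = (\<integral>\<omega>. h (\<omega> t) * clip (reward_of (\<omega> t)) \<partial>law) +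
        discount M * (\<integral>\<omega>. h (\<omega> t) * opt_value (state_of (\<omega> (Suc t))) \<partial>law)"
      using h_int[OF clip_int] h_int[OF opt_int] by (simp add: distrib_left mult.left_commute)
    \<comment> \<open>Averaging over the next state is possible because the test function
      \<open>h\<close> looks no further than time \<open>t\<close>.\<close>
    also have "(\<integral>\<omega>. h (\<omega> t) * opt_value (state_of (\<omega> (Suc t))) \<partial>law) =
        (\<integral>\<omega>. h (\<omega> t) * (\<integral>s. opt_value s \<partial>next_state M (\<omega> t)) \<partial>law)"
      by (rule integral_law_next_state[OF h bounded_opt_valueD(1) h_bound bounded_opt_valueD(2)])
    also have "(\<integral>\<omega>. h (\<omega> t) * clip (reward_of (\<omega> t)) \<partial>law) + discount M * \<dots> =
        (\<integral>\<omega>. h (\<omega> t) * step_value opt_value (\<omega> t) \<partial>law)"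
      using h_int[OF clip_int] h_int[OF next_int]
      by (simp add: step_value_def distrib_left mult.left_commute)
    \<comment> \<open>Disintegration at time \<open>t\<close> with the behaviour policy as control;
      \<open>start\<close> covers \<open>t = 0\<close>, as the first offline action is drawn from
      \<open>p_a\<close> too.\<close>
    also have "\<dots> = (\<integral>\<omega>. \<integral>x. h x * step_value opt_value x \<partial>step_law M (state_of (\<omega> t)) (p_a M (state_of (\<omega> t))) \<partial>law)"
      by (rule integral_law_action[OF start borel_measurable_times[OF h step_value_measurable[OF bounded_opt_value]]
            bound[OF abs_step_value[OF bounded_opt_value]]])
    also have "\<dots> = (\<integral>\<omega>. \<integral>x. h x * Q_opt_step x \<partial>step_law M (state_of (\<omega> t)) (p_a M (state_of (\<omega> t))) \<partial>law)"
      unfolding h_def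
      by (rule Bochner_Integration.integral_cong[OF refl])
        (rule integral_step_law_behaviour[OF state_in_states H H_bound])
    also have "\<dots> = (\<integral>\<omega>. h (\<omega> t) * ?g \<omega> \<partial>law)"
    proof (rule integral_law_action[OF start _ bound[OF abs_Q_opt_step], symmetric])
      show "(\<lambda>x. h x * Q_opt_step x) \<in> borel_measurable (step_space M)"
        using measurable_compose[OF SAM Q_opt_measurable_product] h
        by (simp add: Q_opt_step_def)
    qed
    also have "\<dots> = (\<integral>\<omega>\<in>A. ?g \<omega> \<partial>law)"
      unfolding set_lebesgue_integral_def by (intro Bochner_Integration.integral_cong) (simp_all add: ind)
    finally show "(\<integral>\<omega>\<in>A. ?f \<omega> \<partial>law) = (\<integral>\<omega>\<in>A. ?g \<omega> \<partial>law)" .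
  qed
  then show ?thesis
    unfolding offline by eventually_elim (simp add: Q_opt_step_def)
qed

end

theorem theorem1:
  fixes M :: "('s, 'c, 'a::finite, 'm::finite) m2dp"
    and q :: "'s \<Rightarrow> 'a \<Rightarrow> 'm pmf"
  assumes "m2dp_model M" and "front_door M q"
  shows "(\<exists>\<pi>s.
      \<comment> \<open>a deterministic stationary policy whose return is maximal among all policies\<close>
      optimal M \<pi>s \<and>
      \<comment> \<open>greedy at every state\<close>
      (\<forall>s\<in>space (states M). greedy M q s (\<pi>s s)) \<and>
      \<comment> \<open>unique, if the arg max is a single action at every state\<close>
      ((\<forall>s\<in>space (states M). \<exists>!a. greedy M q s a) \<longrightarrow>
        (\<forall>f. (\<forall>s\<in>space (states M). optimal (started_in M s) f) \<longleftrightarrow>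
             f \<in> states M \<rightarrow>\<^sub>M count_space UNIV \<and> (\<forall>s\<in>space (states M). f s = \<pi>s s)) \<and>
        (\<forall>f. optimal M f \<longrightarrow>
             (\<forall>t. discount M ^ t > 0 \<longrightarrow>
                (AE \<omega> in online M (det_stationary f). f (state_of (\<omega> t)) = \<pi>s (state_of (\<omega> t))))))) \<and>
    \<comment> \<open>unique up to the choice among maximizers, in general\<close>
    (\<forall>f. (\<forall>s\<in>space (states M). optimal (started_in M s) f) \<longleftrightarrow>
         f \<in> states M \<rightarrow>\<^sub>M count_space UNIV \<and> (\<forall>s\<in>space (states M). greedy M q s (f s))) \<and>
    (\<forall>f. optimal M f \<longrightarrow>
         (\<forall>t. discount M ^ t > 0 \<longrightarrow>
            (AE \<omega> in online M (det_stationary f). greedy M q (state_of (\<omega> t)) (f (state_of (\<omega> t)))))) \<and>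
    \<comment> \<open>the Bellman optimality equation\<close>
    (\<forall>t. AE \<omega> in offline M.
      Q_opt M (state_of (\<omega> t)) (action_of (\<omega> t)) (mediator_of (\<omega> t)) =
      real_cond_exp (offline M) (sigma_SAM M t)
        (\<lambda>\<omega>. reward_of (\<omega> t) + discount M * (MAX a. weighted_Q M q (state_of (\<omega> (Suc t))) a)) \<omega>)"
proof -
  interpret m2dp_model M by fact
  obtain R where R: "\<forall>s\<in>space (states M). \<forall>c\<in>space (confs M). \<forall>a m. AE r in p_r M s c a m. \<bar>r\<bar> \<le> R"
    using bounded_rewards by blast
  \<comment> \<open>The absolute value meets the sign condition of the locale and keeps the bound
    valid.\<close>
  interpret front_door_model M q "\<bar>R\<bar>"
  proof
    show "front_door M q" by fact
    show "AE r in p_r M s c a m. \<bar>r\<bar> \<le> \<bar>R\<bar>"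
      if "s \<in> space (states M)" "c \<in> space (confs M)" for s c a m
      using R[rule_format, OF that, of a m] by eventually_elim linarith
  qed simp
  have greedy_optimal: "optimal M greedy_action"
    unfolding optimal_iff
    using online_return_greedy[OF init greedy_action_measurable greedy_action(1)] greedy_action_measurable
    by simp
  have greedy_greedy: "\<forall>s\<in>space (states M). greedy M q s (greedy_action s)"
    by (simp add: greedy_iff greedy_action)
  have everywhere: "(\<forall>s\<in>space (states M). optimal (started_in M s) f) \<longleftrightarrow>
      f \<in> states M \<rightarrow>\<^sub>M count_space UNIV \<and> (\<forall>s\<in>space (states M). greedy M q s (f s))" for f
    unfolding optimal_everywhere_iff by (simp add: greedy_iff)
  \<comment> \<open>Membership in the state space is recorded along with greediness because
    uniqueness of the maximizer is assumed only there.\<close>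
  have along: "AE \<omega> in online M (det_stationary f). state_of (\<omega> t) \<in> space (states M) \<and>
      greedy M q (state_of (\<omega> t)) (f (state_of (\<omega> t)))"
    if f: "optimal M f" and t: "discount M ^ t > 0" for f t
  proof -
    have meas: "f \<in> states M \<rightarrow>\<^sub>M count_space UNIV" using f by (simp add: optimal_def)
    have "AE \<omega> in online M (det_stationary f).
        action_value opt_value (state_of (\<omega> t)) (f (state_of (\<omega> t))) = opt_value (state_of (\<omega> t))"
      unfolding online_eq
      by (rule online_return_optimal_imp[OF init meas _ t]) (use f in \<open>simp add: optimal_iff\<close>)
    moreover have "AE \<omega> in online M (det_stationary f). state_of (\<omega> t) \<in> space (states M)"
      unfolding online_eq
      by (rule AE_I2) (rule state_in_states_online[OF init det_stationary_policy[OF meas]])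
    ultimately show ?thesis by eventually_elim (simp add: greedy_iff)
  qed
  have unique: "b = greedy_action s"
    if "\<forall>s\<in>space (states M). \<exists>!a. greedy M q s a" "s \<in> space (states M)" "greedy M q s b" for s b
    using that greedy_greedy by blast
  show ?thesis
  proof (intro conjI allI impI exI[of _ greedy_action])
    show "optimal M greedy_action" by (fact greedy_optimal)
    show "\<forall>s\<in>space (states M). greedy M q s (greedy_action s)" by (fact greedy_greedy)
    show "(\<forall>s\<in>space (states M). optimal (started_in M s) f) \<longleftrightarrow>
        f \<in> states M \<rightarrow>\<^sub>M count_space UNIV \<and> (\<forall>s\<in>space (states M). f s = greedy_action s)"
      if "\<forall>s\<in>space (states M). \<exists>!a. greedy M q s a" for f
      unfolding everywhere using unique[OF that] greedy_greedy by (metis (no_types, lifting))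
    show "AE \<omega> in online M (det_stationary f). f (state_of (\<omega> t)) = greedy_action (state_of (\<omega> t))"
      if "\<forall>s\<in>space (states M). \<exists>!a. greedy M q s a" "optimal M f" "discount M ^ t > 0" for f t
      using along[OF that(2,3)] by eventually_elim (rule unique[OF that(1)], auto)
    show "(\<forall>s\<in>space (states M). optimal (started_in M s) f) \<longleftrightarrow>
        f \<in> states M \<rightarrow>\<^sub>M count_space UNIV \<and> (\<forall>s\<in>space (states M). greedy M q s (f s))" for f
      by (rule everywhere)
    show "AE \<omega> in online M (det_stationary f). greedy M q (state_of (\<omega> t)) (f (state_of (\<omega> t)))"
      if "optimal M f" "discount M ^ t > 0" for f t
      using along[OF that] by eventually_elim (rule conjunct2)
  qed (rule bellman_equation)
qed

end
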